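(* Let $\Omega$ be a finite set with $|\Omega|\ge2$, let $P=(p(x,y))_{x,y\in\Omega}$ be an irreducible Markov kernel on $\Omega$ that is reversible with respect to $\pi$, and fix an integer $n\ge2$. Let $U=(U_1,\dots,U_n)$ have law $\mu_n$. Let $d\ge1$ and let $g:\Omega\to\mathbb H_d$ satisfy $\max_{x\in\Omega}\|g(x)\|\le1$. Then, for every $t>0$, $$\mathbb P_{\mu_n}\left(\left\|\frac1n\sum_{i=1}^n g(U_i)-\pi(g)\right\|\ge t\right)\le 6d\exp\left(-n\sqrt{\frac{\operatorname{Gap}(\widetilde P_n)}{2}}\;t\right).$$ Moreover, $$\mathbb E_{\mu_n}\left\|\frac1n\sum_{i=1}^n g(U_i)-\pi(g)\right\|\le\frac{\sqrt2\,\log(6\mathrm e d)}{n\sqrt{\operatorname{Gap}(\widetilde P_n)}}.$$ Here $\widetilde P_n$ is the resampled sliding-window count kernel of window length $n$ associated with $P$.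
   Context: $\mathbb H_d$ is the real vector space of $d\times d$ Hermitian matrices, $\|\cdot\|$ is the $\ell_2$ operator norm, $\pi(g)=\sum_{x\in\Omega}\pi(x)g(x)$, $\log$ is the natural logarithm and $\mathrm e=\exp(1)$. $\pi$ is the stationary distribution of $P$; reversibility means $\pi(x)p(x,y)=\pi(y)p(y,x)$ for all $x,y$. Path law: for $u=(u_1,\dots,u_n)\in\Omega^n$, $\mu_n(u)=\pi(u_1)\prod_{i=1}^{n-1}p(u_i,u_{i+1})$. Counts: $N(u)=(N_x(u))_{x\in\Omega}$ with $N_x(u)=\#\{1\le i\le n:u_i=x\}$; $\Omega_n^{\#}=\{\eta\in\mathbb N^{\Omega}:\sum_x\eta_x=n\}$ (with $0\in\mathbb N$). The count law is $\widetilde\mu_n(\eta)=\sum_{u:N(u)=\eta}\mu_n(u)$, and $\Omega_{n,+}^{\#}=\{\eta\in\Omega_n^{\#}:\widetilde\mu_n(\eta)>0\}$. Let $e_x$ denote the unit vector at coordinate $x$ in $\mathbb N^\Omega$. Count kernel on $\Omega_{n,+}^{\#}$: $$\widetilde P_n(\eta,\xi)=\frac1{\widetilde\mu_n(\eta)}\sum_{u\in\Omega^n:\,N(u)=\eta}\mu_n(u)\sum_{z\in\Omega}p(u_n,z)\,\mathbf 1_{\{\eta-e_{u_1}+e_z=\xi\}} .$$ It is reversible with respect to $\widetilde\mu_n$. Spectral gap: for a Markov kernel $K$ on a finite set $S$ reversible with respect to a probability measure $\rho$, $\mathcal E_K(f,f)=\frac12\sum_{x,y\in S}\rho(x)K(x,y)(f(y)-f(x))^2$,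 $\operatorname{Var}_\rho(f)$ is the variance of $f$ under $\rho$, and $\operatorname{Gap}(K)=\inf\{\mathcal E_K(f,f)/\operatorname{Var}_\rho(f): f:S\to\mathbb R,\ \operatorname{Var}_\rho(f)>0\}$ (infimum in $[0,\infty]$, with $\inf\emptyset=+\infty$, $\exp(-\infty)=0$ and $1/\infty=0$, relevant only if $\Omega_{n,+}^{\#}$ is a single point). *)

theory Defs
  imports "HOL-Probability.Probability"
begin

section \<open>Hermitian matrices\<close>

definition hermitian :: "complex ^ 'd ^ 'd \<Rightarrow> bool" where
  "hermitian A \<longleftrightarrow> (\<forall>i j. A $ i $ j = cnj (A $ j $ i))"

(* The norm of the library type complex ^ 'd is the l2 norm. *)
definition op_norm :: "complex ^ 'd ^ 'd \<Rightarrow> real" where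
  "op_norm A = onorm (\<lambda>v. A *v v)"


section \<open>Markov kernels on a finite state space\<close>

definition markov_kernel :: "('a::finite \<Rightarrow> 'a \<Rightarrow> real) \<Rightarrow> bool" where
  "markov_kernel p \<longleftrightarrow> (\<forall>x y. 0 \<le> p x y) \<and> (\<forall>x. (\<Sum>y\<in>UNIV. p x y) = 1)"

primrec kernel_pow :: "('a::finite \<Rightarrow> 'a \<Rightarrow> real) \<Rightarrow> nat \<Rightarrow> 'a \<Rightarrow> 'a \<Rightarrow> real" where
  "kernel_pow p 0 x y = (if x = y then 1 else 0)"
| "kernel_pow p (Suc k) x y = (\<Sum>z\<in>UNIV. p x z * kernel_pow p k z y)"

definition irreducible_kernel :: "('a::finite \<Rightarrow> 'a \<Rightarrow> real) \<Rightarrow> bool" where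
  "irreducible_kernel p \<longleftrightarrow> (\<forall>x y. \<exists>k. 0 < kernel_pow p k x y)"

definition stationary :: "('a::finite \<Rightarrow> 'a \<Rightarrow> real) \<Rightarrow> ('a \<Rightarrow> real) \<Rightarrow> bool" where
  "stationary p \<pi> \<longleftrightarrow>
     (\<forall>x. 0 \<le> \<pi> x) \<and> (\<Sum>x\<in>UNIV. \<pi> x) = 1 \<and> (\<forall>y. (\<Sum>x\<in>UNIV. \<pi> x * p x y) = \<pi> y)"

definition reversible :: "('a::finite \<Rightarrow> 'a \<Rightarrow> real) \<Rightarrow> ('a \<Rightarrow> real) \<Rightarrow> bool" where
  "reversible p \<pi> \<longleftrightarrow> (\<forall>x y. \<pi> x * p x y = \<pi> y * p y x)"

definition mean :: "('a::finite \<Rightarrow> real) \<Rightarrow> ('a \<Rightarrow> 'b::real_vector) \<Rightarrow> 'b" where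
  "mean \<pi> g = (\<Sum>x\<in>UNIV. \<pi> x *\<^sub>R g x)"


section \<open>Paths and their counts\<close>

(* A path (u_1, ..., u_n) is an extensional function on the index set {1..n}. *)
definition paths :: "nat \<Rightarrow> (nat \<Rightarrow> 'a) set" where
  "paths n = {1..n} \<rightarrow>\<^sub>E UNIV"

definition path_law ::
  "('a::finite \<Rightarrow> 'a \<Rightarrow> real) \<Rightarrow> ('a \<Rightarrow> real) \<Rightarrow> nat \<Rightarrow> (nat \<Rightarrow> 'a) \<Rightarrow> real" where
  "path_law p \<pi> n u = \<pi> (u 1) * (\<Prod>i = 1..n - 1. p (u i) (u (i + 1)))"

definition counts :: "nat \<Rightarrow> (nat \<Rightarrow> 'a) \<Rightarrow> 'a \<Rightarrow> nat" where
  "counts n u x = card {i \<in> {1..n}. u i = x}"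

definition count_space_n :: "nat \<Rightarrow> ('a::finite \<Rightarrow> nat) set" where
  "count_space_n n = {\<eta>. (\<Sum>x\<in>UNIV. \<eta> x) = n}"

definition count_law ::
  "('a::finite \<Rightarrow> 'a \<Rightarrow> real) \<Rightarrow> ('a \<Rightarrow> real) \<Rightarrow> nat \<Rightarrow> ('a \<Rightarrow> nat) \<Rightarrow> real" where
  "count_law p \<pi> n \<eta> = (\<Sum>u | u \<in> paths n \<and> counts n u = \<eta>. path_law p \<pi> n u)"

definition count_supp ::
  "('a::finite \<Rightarrow> 'a \<Rightarrow> real) \<Rightarrow> ('a \<Rightarrow> real) \<Rightarrow> nat \<Rightarrow> ('a \<Rightarrow> nat) set" where
  "count_supp p \<pi> n = {\<eta> \<in> count_space_n n. 0 < count_law p \<pi> n \<eta>}"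

definition unit_count :: "'a \<Rightarrow> 'a \<Rightarrow> nat" where
  "unit_count x y = (if y = x then 1 else 0)"

(* The subtraction on nat never truncates: counts n u = \<eta> and n \<ge> 1 give \<eta> (u 1) \<ge> 1.
   The kernel is only used for \<eta> and \<xi> in count_supp p \<pi> n. *)
definition count_kernel ::
  "('a::finite \<Rightarrow> 'a \<Rightarrow> real) \<Rightarrow> ('a \<Rightarrow> real) \<Rightarrow> nat \<Rightarrow> ('a \<Rightarrow> nat) \<Rightarrow> ('a \<Rightarrow> nat) \<Rightarrow> real" where
  "count_kernel p \<pi> n \<eta> \<xi> =
     1 / count_law p \<pi> n \<eta> *
     (\<Sum>u | u \<in> paths n \<and> counts n u = \<eta>. path_law p \<pi> n u *
        (\<Sum>z\<in>UNIV. p (u n) z *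
           (if (\<lambda>x. \<eta> x - unit_count (u 1) x + unit_count z x) = \<xi> then 1 else 0)))"


section \<open>Spectral gap\<close>

definition dirichlet_form :: "'s set \<Rightarrow> ('s \<Rightarrow> real) \<Rightarrow> ('s \<Rightarrow> 's \<Rightarrow> real) \<Rightarrow> ('s \<Rightarrow> real) \<Rightarrow> real" where
  "dirichlet_form S \<rho> K f = 1 / 2 * (\<Sum>x\<in>S. \<Sum>y\<in>S. \<rho> x * K x y * (f y - f x)\<^sup>2)"

definition variance_on :: "'s set \<Rightarrow> ('s \<Rightarrow> real) \<Rightarrow> ('s \<Rightarrow> real) \<Rightarrow> real" where
  "variance_on S \<rho> f = (\<Sum>x\<in>S. \<rho> x * (f x - (\<Sum>y\<in>S. \<rho> y * f y))\<^sup>2)"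

(* Test functions are total, but only their values on S matter.
   The infimum is \<infinity> if no f has positive variance. *)
definition spectral_gap :: "'s set \<Rightarrow> ('s \<Rightarrow> real) \<Rightarrow> ('s \<Rightarrow> 's \<Rightarrow> real) \<Rightarrow> ereal" where
  "spectral_gap S \<rho> K =
     (INF f \<in> {f. 0 < variance_on S \<rho> f}. ereal (dirichlet_form S \<rho> K f / variance_on S \<rho> f))"

definition count_gap :: "('a::finite \<Rightarrow> 'a \<Rightarrow> real) \<Rightarrow> ('a \<Rightarrow> real) \<Rightarrow> nat \<Rightarrow> ereal" where
  "count_gap p \<pi> n = spectral_gap (count_supp p \<pi> n) (count_law p \<pi> n) (count_kernel p \<pi> n)"


section \<open>Square root and exponential on the extended reals\<close>

definition ereal_sqrt :: "ereal \<Rightarrow> ereal" where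
  "ereal_sqrt a = (if a = \<infinity> then \<infinity> else ereal (sqrt (real_of_ereal a)))"

definition ereal_exp :: "ereal \<Rightarrow> ereal" where
  "ereal_exp a =
     (if a = \<infinity> then \<infinity> else if a = -\<infinity> then 0 else ereal (exp (real_of_ereal a)))"

end

theory Submission
  imports Defs
begin

text \<open>
  The argument is that of Huang and Tropp. Let \<open>F \<eta> = (1/n) \<Sum>\<^sub>x \<eta>\<^sub>x g x - \<pi>(g)\<close>, a centred matrix function on the
  count space which changes by at most \<open>2/n\<close> in norm along a move of the count kernel. For
  independent counts \<open>\<eta>, \<xi>\<close> the matrix \<open>sinh (\<theta> (F \<eta> - F \<xi>))\<close> is antisymmetric under exchange, hence
  has mean zero, and the scalar Poincare inequality applied to its entries bounds its expected
  squared Hilbert-Schmidt norm by \<open>(2\<theta>/n)\<^sup>2 / Gap\<close> times \<open>E tr cosh\<^sup>2 (\<theta> (F \<eta> - F \<xi>))\<close>. As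
  \<open>cosh\<^sup>2 = 1 + sinh\<^sup>2\<close>, the inequality closes up when this factor is at most \<open>1/2\<close>, and gives
  \<open>E tr cosh (2\<theta> (F \<eta> - F \<xi>)) \<le> 3d\<close>. Jensen's inequality removes \<open>\<xi>\<close>; the theorem follows by Markov's
  and Jensen's inequalities. Stationarity of \<open>\<pi>\<close> shows that the count law is invariant under the
  count kernel.
\<close>

section \<open>Hyperbolic inequalities\<close>

text \<open>Mean value theorem on the interval from 0 to \<open>y\<close>, where \<open>cosh\<close>
  is increasing; negative arguments follow by parity.\<close>

lemma abs_sinh_le: "\<bar>sinh x\<bar> \<le> \<bar>x\<bar> * cosh (x::real)"
proof -
  have pos: "sinh y \<le> y * cosh y" if "y > 0" for y :: real
  proof -
    have "\<exists>z>0. z < y \<and> sinh y - sinh 0 = (y - 0) * cosh z"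
      using that by (intro MVT2) (auto intro!: derivative_eq_intros)
    then obtain z where z: "0 < z" "z < y" "sinh y = y * cosh z" by auto
    then show ?thesis using that by (simp add: cosh_real_nonneg_le_iff)
  qed
  show ?thesis
    using pos[of x] pos[of "-x"] by (cases "x > 0"; cases "x = 0") (auto simp: abs_if)
qed

text \<open>In terms of the half sum \<open>m\<close> and the half difference \<open>w\<close>, the
  left side factorises as \<open>4 * (cosh m)\<^sup>2 * (sinh w)\<^sup>2\<close>, and
  \<open>abs_sinh_le\<close> bounds the second factor. On the right each \<open>cosh\<close> depends
  on one variable only; for operators this lets one of two eigenbases be summed out.\<close>

lemma sinh_diff_square_le:
  fixes a b :: real
  shows "(sinh a - sinh b)\<^sup>2 \<le> (a - b)\<^sup>2 * ((cosh a)\<^sup>2 + (cosh b)\<^sup>2) / 2"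
proof -
  define m where "m = (a + b) / 2"
  define w where "w = (a - b) / 2"
  have ab: "a = m + w" "b = m - w" by (auto simp: m_def w_def field_simps)
  define s where "s = (sinh w)\<^sup>2"
  define q where "q = (sinh m)\<^sup>2"
  have s0: "0 \<le> s" and q0: "0 \<le> q" by (auto simp: s_def q_def)
  have cs: "(cosh w)\<^sup>2 = s + 1" "(cosh m)\<^sup>2 = q + 1" by (simp_all add: s_def q_def cosh_square_eq)
  have "sinh a - sinh b = 2 * cosh m * sinh w"
    by (simp add: ab sinh_add sinh_diff)
  then have lhs: "(sinh a - sinh b)\<^sup>2 = 4 * (q + 1) * s"
    by (simp add: power_mult_distrib cs s_def)
  have "(cosh a)\<^sup>2 + (cosh b)\<^sup>2 = 2 * (cosh m)\<^sup>2 * (cosh w)\<^sup>2 + 2 * (sinh m)\<^sup>2 * (sinh w)\<^sup>2"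
    by (simp add: ab cosh_add cosh_diff power2_eq_square algebra_simps)
  then have rhs: "(cosh a)\<^sup>2 + (cosh b)\<^sup>2 = 2 * (q + 1) * (s + 1) + 2 * q * s"
    by (simp only: cs s_def[symmetric] q_def[symmetric])
  have "\<bar>sinh w\<bar>\<^sup>2 \<le> (\<bar>w\<bar> * cosh w)\<^sup>2"
    by (intro power_mono abs_sinh_le) auto
  then have "s \<le> w\<^sup>2 * (s + 1)" by (simp add: power_mult_distrib cs s_def)
  then have "4 * (q + 1) * s \<le> 4 * (q + 1) * (w\<^sup>2 * (s + 1))"
    using q0 by (intro mult_left_mono) auto
  also have "\<dots> \<le> 4 * (w\<^sup>2 * ((q + 1) * (s + 1) + q * s))"
    using q0 s0 by (simp add: algebra_simps)
  also have "\<dots> = (a - b)\<^sup>2 * ((cosh a)\<^sup>2 + (cosh b)\<^sup>2) / 2"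
    unfolding rhs by (simp add: ab power2_eq_square algebra_simps)
  finally show ?thesis unfolding lhs .
qed

lemma convex_on_cosh: "convex_on UNIV (\<lambda>x::real. cosh (k * x))"
proof (rule f''_ge0_imp_convex)
  show "((\<lambda>x. cosh (k * x)) has_real_derivative k * sinh (k * x)) (at x)" for x :: real
    by (auto intro!: derivative_eq_intros)
  show "((\<lambda>x. k * sinh (k * x)) has_real_derivative k * k * cosh (k * x)) (at x)" for x :: real
    by (auto intro!: derivative_eq_intros)
qed auto


section \<open>Spectral decomposition of selfadjoint operators\<close>

definition orthonormal_basis :: "'e::euclidean_space set \<Rightarrow> bool" where
  "orthonormal_basis B \<longleftrightarrow>
     finite B \<and> pairwise orthogonal B \<and> (\<forall>b\<in>B. norm b = 1) \<and> span B = UNIV"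

definition selfadjoint :: "('e::euclidean_space \<Rightarrow>\<^sub>L 'e) \<Rightarrow> bool" where
  "selfadjoint A \<longleftrightarrow> (\<forall>x y. inner (A x) y = inner x (A y))"

text \<open>The eigenvalue is written as the Rayleigh quotient \<open>inner b (A b)\<close>, so no
  separate eigenvalue function has to accompany the basis.\<close>

definition eigenbasis :: "('e::euclidean_space \<Rightarrow>\<^sub>L 'e) \<Rightarrow> 'e set \<Rightarrow> bool" where
  "eigenbasis A B \<longleftrightarrow> orthonormal_basis B \<and> (\<forall>b\<in>B. A b = inner b (A b) *\<^sub>R b)"

lemma orthonormal_basis_Basis: "orthonormal_basis (Basis :: 'e::euclidean_space set)"
  by (auto simp: orthonormal_basis_def pairwise_def orthogonal_def inner_Basis)

lemma orthonormal_basis_inner: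
  assumes "orthonormal_basis B" "b \<in> B" "b' \<in> B"
  shows "inner b b' = (if b = b' then 1 else 0)"
  using assms by (auto simp: orthonormal_basis_def pairwise_def orthogonal_def norm_eq_1)

lemma orthonormal_basis_sum:
  assumes "orthonormal_basis B"
  shows "(\<Sum>b\<in>B. inner b x *\<^sub>R b) = x"
  using orthonormal_basis_expand[of B x] assms
  by (auto simp: orthonormal_basis_def inner_commute)

lemma parseval:
  assumes "orthonormal_basis B"
  shows "(\<Sum>b\<in>B. inner b x * inner b y) = inner x y"
proof -
  have "inner x y = inner (\<Sum>b\<in>B. inner b x *\<^sub>R b) y"
    by (simp only: orthonormal_basis_sum[OF assms])
  then show ?thesis by (simp add: inner_sum_left)
qed

lemma parseval_norm:
  assumes "orthonormal_basis B"
  shows "(\<Sum>b\<in>B. (inner b x)\<^sup>2) = (norm x)\<^sup>2"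
  using parseval[OF assms, of x x] by (simp add: power2_eq_square power2_norm_eq_inner[unfolded power2_eq_square])

lemma orthonormal_basis_card:
  assumes "orthonormal_basis (B :: 'e::euclidean_space set)"
  shows "card B = DIM('e)"
proof -
  have "independent B"
    using assms by (intro pairwise_orthogonal_independent) (auto simp: orthonormal_basis_def)
  then have "card B = dim B" by (simp add: dim_eq_card_independent)
  also have "dim B = DIM('e)"
    by (metis assms dim_UNIV dim_span orthonormal_basis_def)
  finally show ?thesis .
qed

text \<open>First variation: \<open>q\<close> below is nonnegative on \<open>V\<close> and vanishes
  at \<open>x\<close>, so its derivative \<open>2 * inner w w\<close> along the residual
  \<open>w\<close> must be zero.\<close>

lemma rayleigh_maximizer_eigenvector:
  fixes A :: "'e::euclidean_space \<Rightarrow>\<^sub>L 'e"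
  assumes A: "selfadjoint A" and V: "subspace V" and inv: "\<And>y. y \<in> V \<Longrightarrow> A y \<in> V"
    and x: "x \<in> V" "norm x = 1"
    and mx: "\<And>y. y \<in> V \<Longrightarrow> norm y = 1 \<Longrightarrow> inner y (A y) \<le> inner x (A x)"
  shows "A x = inner x (A x) *\<^sub>R x"
proof -
  define m where "m = inner x (A x)"
  have le: "inner y (A y) \<le> m * inner y y" if "y \<in> V" for y
  proof (cases "y = 0")
    case False
    have "inner (y /\<^sub>R norm y) (A (y /\<^sub>R norm y)) \<le> m"
      unfolding m_def using that False V by (intro mx) (auto simp: subspace_scale)
    then have "inner y (A y) / (norm y)\<^sup>2 \<le> m"
      by (simp add: blinfun.scaleR_right power2_eq_square field_simps)
    then show ?thesis using False by (simp add: field_simps power2_norm_eq_inner)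
  qed simp
  define w where "w = m *\<^sub>R x - A x"
  have w: "w \<in> V" unfolding w_def using V x inv by (auto intro: subspace_diff subspace_scale)
  define q where "q y = m * inner y y - inner y (A y)" for y
  have q: "q (x + t *\<^sub>R w) = 2 * t * inner w w + t\<^sup>2 * q w" for t
  proof -
    have xx: "inner x x = 1" using x by (simp add: norm_eq_1)
    have aw: "inner w (A x) = inner x (A w)"
      using A by (metis inner_commute selfadjoint_def)
    have "inner w w = m * inner w x - inner w (A x)"
      by (simp add: w_def algebra_simps inner_commute)
    then have "t * inner w w = t * (m * inner w x - inner w (A x))" by simp
    then show ?thesis
      by (simp add: q_def blinfun.add_right blinfun.scaleR_right algebra_simps inner_commute[of x w]
          power2_eq_square xx aw[symmetric] m_def[symmetric])
  qed
  have q0: "0 \<le> q y" if "y \<in> V" for y using le[OF that] by (simp add: q_def)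
  have "inner w w = 0"
  proof (rule ccontr)
    assume "inner w w \<noteq> 0"
    then have pos: "0 < inner w w" using inner_ge_zero[of w] by linarith
    \<comment> \<open>A negative step, so short that the quadratic term cannot outweigh the linear
      one; the \<open>+ 1\<close> keeps the denominator positive when
      \<open>q w = 0\<close>.\<close>
    define t where "t = - inner w w / (q w + 1)"
    have qw: "0 \<le> q w" by (rule q0[OF w])
    have "0 \<le> q (x + t *\<^sub>R w)" using V x w by (intro q0) (auto intro: subspace_add subspace_scale)
    also have "\<dots> = t * (2 * inner w w + t * q w)" unfolding q by (simp add: power2_eq_square algebra_simps)
    finally have 1: "0 \<le> t * (2 * inner w w + t * q w)" .
    have "t * q w = - inner w w * (q w / (q w + 1))" by (simp add: t_def)
    also have "\<dots> \<ge> - inner w w * 1" using pos qw by (intro mult_left_mono_neg) (auto simp: field_simps)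
    finally have "0 < 2 * inner w w + t * q w" using pos by linarith
    moreover have "t < 0" using pos qw by (simp add: t_def field_simps)
    ultimately show False using 1 by (meson mult_neg_pos not_less)
  qed
  then show ?thesis by (simp add: w_def m_def)
qed

text \<open>An orthonormal set of eigenvectors of largest cardinality must span: otherwise its
  orthogonal complement is a nonzero invariant subspace, and a maximizer of the Rayleigh quotient on
  the unit sphere there enlarges the set.\<close>

theorem eigenbasis_exists:
  fixes A :: "'e::euclidean_space \<Rightarrow>\<^sub>L 'e"
  assumes A: "selfadjoint A"
  obtains B where "eigenbasis A B"
proof -
  define P where "P B \<longleftrightarrow> finite B \<and> pairwise orthogonal B \<and>
    (\<forall>b\<in>B. norm b = 1 \<and> A b = inner b (A b) *\<^sub>R b)" for B
  have bound: "card B \<le> DIM('e)" if "P B" for B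
  proof -
    have "independent B"
      using that by (intro pairwise_orthogonal_independent) (auto simp: P_def)
    then show ?thesis by (simp add: independent_bound)
  qed
  have "\<exists>B. P B \<and> (\<forall>B'. P B' \<longrightarrow> card B' \<le> card B)"
    by (rule ex_has_greatest_nat[where k="{}" and b="Suc (DIM('e))"]) (auto simp: P_def[of "{}"] less_Suc_eq_le bound)
  then obtain B where B: "P B" and max: "\<And>B'. P B' \<Longrightarrow> card B' \<le> card B" by blast
  have "span B = UNIV"
  proof (rule ccontr)
    assume "span B \<noteq> UNIV"
    define V where "V = {y. \<forall>b\<in>B. inner b y = 0}"
    have V: "subspace V" by (auto simp: V_def subspace_def inner_add_right)
    have inv: "A y \<in> V" if "y \<in> V" for y
    proof -
      have "inner b (A y) = 0" if b: "b \<in> B" for b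
      proof -
        have "inner b (A y) = inner (A b) y" using A by (simp add: selfadjoint_def)
        also have "\<dots> = inner (inner b (A b) *\<^sub>R b) y" using B b by (auto simp: P_def)
        also have "\<dots> = 0" using \<open>y \<in> V\<close> b by (simp add: V_def)
        finally show ?thesis .
      qed
      then show ?thesis by (simp add: V_def)
    qed
    from \<open>span B \<noteq> UNIV\<close> obtain a where "a \<noteq> 0" and a: "\<forall>x\<in>span B. inner a x = 0"
      using span_not_UNIV_orthogonal[of B] by auto
    then have "a \<in> V" by (auto simp: V_def inner_commute span_base)
    define S where "S = V \<inter> sphere 0 1"
    have "compact S" unfolding S_def using V
      by (auto intro!: closed_Int_compact closed_subspace)
    moreover have "a /\<^sub>R norm a \<in> S" using \<open>a \<noteq> 0\<close> \<open>a \<in> V\<close> V by (auto simp: S_def subspace_scale)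
    moreover have "continuous_on S (\<lambda>y. inner y (A y))" by (intro continuous_intros)
    ultimately obtain x where x: "x \<in> S" and mx: "\<And>y. y \<in> S \<Longrightarrow> inner y (A y) \<le> inner x (A x)"
      using continuous_attains_sup[of S "\<lambda>y. inner y (A y)"] by blast
    have ev: "A x = inner x (A x) *\<^sub>R x"
      using x mx by (intro rayleigh_maximizer_eigenvector[OF A V inv]) (auto simp: S_def)
    have xn: "norm x = 1" and xV: "x \<in> V" using x by (auto simp: S_def)
    have "x \<notin> B" using xV xn by (auto simp: V_def norm_eq_1)
    moreover have "P (insert x B)" using B ev xn xV
      by (auto simp: P_def V_def pairwise_insert orthogonal_def inner_commute)
    ultimately show False using max[of "insert x B"] B by (auto simp: P_def)
  qed
  then have "eigenbasis A B" using B by (auto simp: eigenbasis_def orthonormal_basis_def P_def)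
  then show ?thesis by (rule that)
qed


section \<open>Functional calculus and trace inequalities\<close>

definition eigvecs :: "('e::euclidean_space \<Rightarrow>\<^sub>L 'e) \<Rightarrow> 'e set" where
  "eigvecs A = (SOME B. eigenbasis A B)"

text \<open>For selfadjoint \<open>A\<close> this is the operator \<phi>(A) of the spectral
  calculus, and \<open>ftrace\<close> is its trace, both computed in one fixed eigenbasis.\<close>

definition fcalc :: "(real \<Rightarrow> real) \<Rightarrow> ('e::euclidean_space \<Rightarrow>\<^sub>L 'e) \<Rightarrow> 'e \<Rightarrow> 'e" where
  "fcalc \<phi> A x = (\<Sum>b\<in>eigvecs A. \<phi> (inner b (A b)) *\<^sub>R (inner b x *\<^sub>R b))"

definition ftrace :: "(real \<Rightarrow> real) \<Rightarrow> ('e::euclidean_space \<Rightarrow>\<^sub>L 'e) \<Rightarrow> real" where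
  "ftrace \<phi> A = (\<Sum>b\<in>eigvecs A. \<phi> (inner b (A b)))"

lemma eigenbasis_eigvecs:
  assumes "selfadjoint A"
  shows "eigenbasis A (eigvecs A)"
  unfolding eigvecs_def by (metis assms eigenbasis_exists someI)

lemma orthonormal_basis_eigvecs: "selfadjoint A \<Longrightarrow> orthonormal_basis (eigvecs A)"
  using eigenbasis_eigvecs by (auto simp: eigenbasis_def)

lemma eigvecs_eigenvector:
  assumes "selfadjoint A" "b \<in> eigvecs A"
  shows "A b = inner b (A b) *\<^sub>R b"
  using eigenbasis_eigvecs[OF assms(1)] assms(2) unfolding eigenbasis_def by blast

lemma inner_eigvecs_apply:
  assumes "selfadjoint A" "b \<in> eigvecs A"
  shows "inner b (A x) = inner b (A b) * inner b x"
proof -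
  have "inner b (A x) = inner (A b) x" using assms by (simp add: selfadjoint_def)
  also have "\<dots> = inner (inner b (A b) *\<^sub>R b) x"
    using eigvecs_eigenvector[OF assms] by (rule arg_cong)
  finally show ?thesis by simp
qed

lemma linear_fcalc: "linear (fcalc \<phi> A)"
  unfolding fcalc_def
  by (intro linear_compose_sum ballI linearI) (auto simp: algebra_simps)

lemma inner_fcalc:
  assumes "selfadjoint A" "b \<in> eigvecs A"
  shows "inner b (fcalc \<phi> A x) = \<phi> (inner b (A b)) * inner b x"
proof -
  note ob = orthonormal_basis_eigvecs[OF assms(1)]
  have "inner b (fcalc \<phi> A x) =
      (\<Sum>c\<in>eigvecs A. if c = b then \<phi> (inner b (A b)) * inner b x else 0)"
    unfolding fcalc_def inner_sum_right
    by (rule sum.cong) (auto simp: orthonormal_basis_inner[OF ob assms(2)])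
  then show ?thesis using ob assms(2) by (simp add: orthonormal_basis_def)
qed

lemma fcalc_eigvecs:
  assumes "selfadjoint A" "b \<in> eigvecs A"
  shows "fcalc \<phi> A b = \<phi> (inner b (A b)) *\<^sub>R b"
proof -
  note ob = orthonormal_basis_eigvecs[OF assms(1)]
  have "fcalc \<phi> A b = (\<Sum>c\<in>eigvecs A. if c = b then \<phi> (inner b (A b)) *\<^sub>R b else 0)"
    unfolding fcalc_def
    by (rule sum.cong) (auto simp: orthonormal_basis_inner[OF ob _ assms(2)])
  then show ?thesis using ob assms(2) by (simp add: orthonormal_basis_def)
qed

section \<open>Hilbert-Schmidt norms of functions of selfadjoint operators\<close>

definition hs_square :: "('e::euclidean_space \<Rightarrow> 'e) \<Rightarrow> real" where
  "hs_square T = (\<Sum>i\<in>Basis. \<Sum>j\<in>Basis. (inner i (T j))\<^sup>2)"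

text \<open>Parseval in the row index, and, after passing to the adjoint, in the column index. The
  two bases may differ, which makes eigenbases of two non-commuting operators usable at
  once.\<close>

lemma hs_square_eq:
  fixes T :: "'e::euclidean_space \<Rightarrow> 'e"
  assumes T: "linear T" and B: "orthonormal_basis B" and C: "orthonormal_basis C"
  shows "hs_square T = (\<Sum>b\<in>B. \<Sum>c\<in>C. (inner b (T c))\<^sup>2)"
proof -
  have fst: "(\<Sum>b\<in>B. \<Sum>c\<in>C. (inner b (S c))\<^sup>2) = (\<Sum>c\<in>C. (norm (S c))\<^sup>2)"
    if "orthonormal_basis B" for B C :: "'e set" and S
    by (subst sum.swap) (simp add: parseval_norm[OF that])
  have adj: "inner b (T c) = inner c (adjoint T b)" for b c
    by (metis adjoint_works[OF T] inner_commute)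
  have "hs_square T = (\<Sum>j\<in>Basis. (norm (T j))\<^sup>2)"
    unfolding hs_square_def by (rule fst[OF orthonormal_basis_Basis])
  also have "\<dots> = (\<Sum>b\<in>B. \<Sum>j\<in>Basis. (inner b (T j))\<^sup>2)"
    by (rule fst[OF B, symmetric])
  also have "\<dots> = (\<Sum>b\<in>B. (norm (adjoint T b))\<^sup>2)"
    by (simp add: adj parseval_norm[OF orthonormal_basis_Basis])
  also have "\<dots> = (\<Sum>b\<in>B. \<Sum>c\<in>C. (inner b (T c))\<^sup>2)"
    by (simp add: adj parseval_norm[OF C])
  finally show ?thesis .
qed

text \<open>With rows indexed by an eigenbasis of \<open>A\<close> and columns by one of
  \<open>A'\<close>, each entry is a difference of scalar values times \<open>inner b c\<close>.
  Operator inequalities thereby reduce to scalar ones, without commutativity.\<close>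

lemma hs_square_fcalc_diff:
  assumes A: "selfadjoint A" and A': "selfadjoint A'"
  shows "hs_square (\<lambda>x. fcalc \<phi> A x - fcalc \<psi> A' x) =
    (\<Sum>b\<in>eigvecs A. \<Sum>c\<in>eigvecs A'. (\<phi> (inner b (A b)) - \<psi> (inner c (A' c)))\<^sup>2 * (inner b c)\<^sup>2)"
proof -
  have "hs_square (\<lambda>x. fcalc \<phi> A x - fcalc \<psi> A' x) =
    (\<Sum>b\<in>eigvecs A. \<Sum>c\<in>eigvecs A'. (inner b (fcalc \<phi> A c - fcalc \<psi> A' c))\<^sup>2)"
    by (intro hs_square_eq linear_compose_sub linear_fcalc orthonormal_basis_eigvecs A A')
  also have "\<dots> = (\<Sum>b\<in>eigvecs A. \<Sum>c\<in>eigvecs A'.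
      (\<phi> (inner b (A b)) - \<psi> (inner c (A' c)))\<^sup>2 * (inner b c)\<^sup>2)"
    by (intro sum.cong refl)
      (simp add: inner_diff_right inner_fcalc[OF A] fcalc_eigvecs[OF A'] flip: power_mult_distrib left_diff_distrib)
  finally show ?thesis .
qed

lemma hs_square_fcalc:
  assumes A: "selfadjoint A"
  shows "hs_square (fcalc \<phi> A) = ftrace (\<lambda>x. (\<phi> x)\<^sup>2) A"
proof -
  note ob = orthonormal_basis_eigvecs[OF A]
  have "hs_square (fcalc \<phi> A) = (\<Sum>b\<in>eigvecs A. \<Sum>c\<in>eigvecs A. (inner b (fcalc \<phi> A c))\<^sup>2)"
    by (intro hs_square_eq linear_fcalc ob)
  also have "\<dots> = (\<Sum>b\<in>eigvecs A. (\<phi> (inner b (A b)))\<^sup>2 * (\<Sum>c\<in>eigvecs A. (inner c b)\<^sup>2))"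
    by (simp add: inner_fcalc[OF A] power_mult_distrib sum_distrib_left inner_commute)
  also have "\<dots> = ftrace (\<lambda>x. (\<phi> x)\<^sup>2) A"
    unfolding ftrace_def parseval_norm[OF ob]
    using ob by (simp add: orthonormal_basis_def)
  finally show ?thesis .
qed

lemma selfadjoint_minus: "selfadjoint A \<Longrightarrow> selfadjoint (- A)"
  by (simp add: selfadjoint_def blinfun.minus_left)

lemma selfadjoint_diff: "selfadjoint A \<Longrightarrow> selfadjoint A' \<Longrightarrow> selfadjoint (A - A')"
  by (simp add: selfadjoint_def blinfun.diff_left inner_diff_left inner_diff_right)

text \<open>The eigenbases chosen for \<open>A\<close> and \<open>- A\<close> need not be related,
  so the identity is derived from a vanishing Hilbert-Schmidt distance: whenever
  \<open>inner b c\<close> is nonzero, the eigenvalues belonging to \<open>b\<close> and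
  \<open>c\<close> are opposite.\<close>

lemma fcalc_uminus:
  fixes A :: "'e::euclidean_space \<Rightarrow>\<^sub>L 'e"
  assumes A: "selfadjoint A" and odd: "\<And>x. \<phi> (- x) = - \<phi> x"
    and ij: "i \<in> Basis" "j \<in> Basis"
  shows "inner i (fcalc \<phi> (- A) j) = - inner i (fcalc \<phi> A j)"
proof -
  have zero: "(\<phi> (inner b ((- A) b)) - (- \<phi> (inner c (A c))))\<^sup>2 * (inner b c)\<^sup>2 = 0"
    if b: "b \<in> eigvecs (- A)" and c: "c \<in> eigvecs A" for b c
  proof (cases "inner b c = 0")
    case False
    have "inner b ((- A) b) * inner b c = inner b ((- A) c)"
      by (rule inner_eigvecs_apply[OF selfadjoint_minus[OF A] b, symmetric])
    also have "\<dots> = - inner b (A c)" by (simp add: blinfun.minus_left)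
    also have "\<dots> = - (inner c (A c) * inner b c)"
      using eigvecs_eigenvector[OF A c] by (metis inner_scaleR_right)
    finally have "inner b ((- A) b) = - inner c (A c)"
      using False by (metis minus_mult_left mult_right_cancel)
    then show ?thesis by (simp add: odd)
  qed simp
  have "hs_square (\<lambda>x. fcalc \<phi> (- A) x - fcalc (\<lambda>x. - \<phi> x) A x) = 0"
    unfolding hs_square_fcalc_diff[OF selfadjoint_minus[OF A] A]
    by (intro sum.neutral ballI zero)
  then have "(inner i (fcalc \<phi> (- A) j - fcalc (\<lambda>x. - \<phi> x) A j))\<^sup>2 = 0"
    using ij unfolding hs_square_def
    by (subst (asm) sum_nonneg_eq_0_iff, auto intro!: sum_nonneg)
       (subst (asm) sum_nonneg_eq_0_iff, auto)
  moreover have "fcalc (\<lambda>x. - \<phi> x) A j = - fcalc \<phi> A j"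
    by (simp add: fcalc_def sum_negf)
  ultimately show ?thesis by (simp add: inner_add_right)
qed

text \<open>In mixed eigenbases \<open>sinh_diff_square_le\<close> applies entry by entry, and
  \<open>(\<alpha> b - \<gamma> c) * inner b c\<close> is an entry of \<open>D = A - A'\<close>.
  Each \<open>cosh\<close> factor involves one index, so Parseval sums the other one to a squared
  norm of \<open>D b\<close> or \<open>D c\<close>.\<close>

lemma hs_square_sinh_diff_le:
  assumes A: "selfadjoint A" and A': "selfadjoint A'" and r: "norm (A - A') \<le> r"
  shows "hs_square (\<lambda>x. fcalc (\<lambda>s. sinh (\<theta> * s)) A x - fcalc (\<lambda>s. sinh (\<theta> * s)) A' x) \<le>
    (\<theta> * r)\<^sup>2 / 2 * (ftrace (\<lambda>s. (cosh (\<theta> * s))\<^sup>2) A + ftrace (\<lambda>s. (cosh (\<theta> * s))\<^sup>2) A')"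
proof -
  note oA = orthonormal_basis_eigvecs[OF A] and oA' = orthonormal_basis_eigvecs[OF A']
  define D where "D = A - A'"
  have D: "selfadjoint D" unfolding D_def by (rule selfadjoint_diff[OF A A'])
  define \<alpha> where "\<alpha> b = inner b (A b)" for b
  define \<gamma> where "\<gamma> c = inner c (A' c)" for c
  have Dle: "(norm (D b))\<^sup>2 \<le> r\<^sup>2" if "norm b = 1" for b
    using norm_blinfun[of D b] that r by (intro power_mono) (auto simp: D_def)
  have key: "(sinh (\<theta> * \<alpha> b) - sinh (\<theta> * \<gamma> c))\<^sup>2 * (inner b c)\<^sup>2 \<le>
     \<theta>\<^sup>2 / 2 * ((cosh (\<theta> * \<alpha> b))\<^sup>2 * (inner c (D b))\<^sup>2 + (cosh (\<theta> * \<gamma> c))\<^sup>2 * (inner b (D c))\<^sup>2)"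
    if b: "b \<in> eigvecs A" and c: "c \<in> eigvecs A'" for b c
  proof -
    have e: "inner b (D c) = (\<alpha> b - \<gamma> c) * inner b c"
      using inner_eigvecs_apply[OF A b, of c] arg_cong[OF eigvecs_eigenvector[OF A' c], of "inner b"]
      by (simp add: D_def blinfun.diff_left inner_diff_right \<alpha>_def \<gamma>_def left_diff_distrib)
    have e': "inner c (D b) = inner b (D c)" using D by (metis inner_commute selfadjoint_def)
    have "(sinh (\<theta> * \<alpha> b) - sinh (\<theta> * \<gamma> c))\<^sup>2 * (inner b c)\<^sup>2 \<le>
        ((\<theta> * \<alpha> b - \<theta> * \<gamma> c)\<^sup>2 * ((cosh (\<theta> * \<alpha> b))\<^sup>2 + (cosh (\<theta> * \<gamma> c))\<^sup>2) / 2) * (inner b c)\<^sup>2"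
      by (intro mult_right_mono sinh_diff_square_le) auto
    also have "\<dots> = \<theta>\<^sup>2 / 2 * ((cosh (\<theta> * \<alpha> b))\<^sup>2 + (cosh (\<theta> * \<gamma> c))\<^sup>2) * ((\<alpha> b - \<gamma> c) * inner b c)\<^sup>2"
      by (simp add: power_mult_distrib flip: right_diff_distrib)
    finally show ?thesis unfolding e' e[symmetric] by (simp add: algebra_simps)
  qed
  have "hs_square (\<lambda>x. fcalc (\<lambda>s. sinh (\<theta> * s)) A x - fcalc (\<lambda>s. sinh (\<theta> * s)) A' x) =
    (\<Sum>b\<in>eigvecs A. \<Sum>c\<in>eigvecs A'. (sinh (\<theta> * \<alpha> b) - sinh (\<theta> * \<gamma> c))\<^sup>2 * (inner b c)\<^sup>2)"
    unfolding hs_square_fcalc_diff[OF A A'] \<alpha>_def \<gamma>_def ..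
  also have "\<dots> \<le> (\<Sum>b\<in>eigvecs A. \<Sum>c\<in>eigvecs A'. \<theta>\<^sup>2 / 2 *
      ((cosh (\<theta> * \<alpha> b))\<^sup>2 * (inner c (D b))\<^sup>2 + (cosh (\<theta> * \<gamma> c))\<^sup>2 * (inner b (D c))\<^sup>2))"
    by (intro sum_mono key)
  also have "\<dots> = \<theta>\<^sup>2 / 2 *
      ((\<Sum>b\<in>eigvecs A. (cosh (\<theta> * \<alpha> b))\<^sup>2 * (\<Sum>c\<in>eigvecs A'. (inner c (D b))\<^sup>2)) +
       (\<Sum>c\<in>eigvecs A'. (cosh (\<theta> * \<gamma> c))\<^sup>2 * (\<Sum>b\<in>eigvecs A. (inner b (D c))\<^sup>2)))"
    unfolding sum.distrib distrib_left sum_distrib_left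
    by (subst (2) sum.swap) simp
  also have "\<dots> \<le> \<theta>\<^sup>2 / 2 *
      ((\<Sum>b\<in>eigvecs A. (cosh (\<theta> * \<alpha> b))\<^sup>2 * r\<^sup>2) + (\<Sum>c\<in>eigvecs A'. (cosh (\<theta> * \<gamma> c))\<^sup>2 * r\<^sup>2))"
    unfolding parseval_norm[OF oA] parseval_norm[OF oA'] using oA oA'
    by (intro mult_left_mono add_mono sum_mono Dle) (auto simp: orthonormal_basis_def)
  also have "\<dots> = (\<theta> * r)\<^sup>2 / 2 *
      (ftrace (\<lambda>s. (cosh (\<theta> * s))\<^sup>2) A + ftrace (\<lambda>s. (cosh (\<theta> * s))\<^sup>2) A')"
    unfolding ftrace_def \<alpha>_def \<gamma>_def sum_distrib_right[symmetric]
    by (simp add: power_mult_distrib algebra_simps)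
  finally show ?thesis .
qed

section \<open>Diagonal entries against eigenvalues\<close>

lemma bessel_inequality:
  fixes v :: "'e::euclidean_space"
  assumes "finite B" "pairwise orthogonal B" "\<And>b. b \<in> B \<Longrightarrow> norm b = 1"
  shows "(\<Sum>b\<in>B. (inner v b)\<^sup>2) \<le> (norm v)\<^sup>2"
proof -
  define w where "w = (\<Sum>b\<in>B. inner v b *\<^sub>R b)"
  have on: "inner b b' = (if b = b' then 1 else 0)" if "b \<in> B" "b' \<in> B" for b b'
    using assms that by (auto simp: pairwise_def orthogonal_def norm_eq_1)
  have vw: "inner v w = (\<Sum>b\<in>B. (inner v b)\<^sup>2)"
    by (simp add: w_def inner_sum_right power2_eq_square)
  have "inner b w = inner v b" if b: "b \<in> B" for b
  proof -
    have "inner b w = (\<Sum>b'\<in>B. if b' = b then inner v b else 0)"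
      unfolding w_def inner_sum_right by (rule sum.cong) (auto simp: on b)
    then show ?thesis using assms(1) b by simp
  qed
  then have "inner w w = (\<Sum>b\<in>B. (inner v b)\<^sup>2)"
    by (subst (1) w_def) (simp add: inner_sum_left power2_eq_square)
  moreover have "0 \<le> inner (v - w) (v - w)" by simp
  ultimately show ?thesis using vw
    by (simp add: inner_diff_left inner_diff_right inner_commute[of w v] power2_norm_eq_inner)
qed

text \<open>Each \<open>inner b (A b)\<close> is an average of eigenvalues with weights
  \<open>(inner v b)\<^sup>2\<close>, so Jensen applies. The total weight received by each
  \<open>v\<close> is at most 1 by Bessel; since \<phi> is nonnegative, \<open>B\<close> is allowed
  not to span.\<close>

lemma peierls_inequality:
  assumes A: "selfadjoint A" and B: "finite B" "pairwise orthogonal B" "\<And>b. b \<in> B \<Longrightarrow> norm b = 1"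
    and conv: "convex_on UNIV \<phi>" and nonneg: "\<And>x. 0 \<le> \<phi> x"
  shows "(\<Sum>b\<in>B. \<phi> (inner b (A b))) \<le> ftrace \<phi> A"
proof -
  note oA = orthonormal_basis_eigvecs[OF A]
  have fin: "finite (eigvecs A)" using oA by (simp add: orthonormal_basis_def)
  have ne: "eigvecs A \<noteq> {}" using orthonormal_basis_card[OF oA] by auto
  have "\<phi> (inner b (A b)) \<le> (\<Sum>v\<in>eigvecs A. (inner v b)\<^sup>2 * \<phi> (inner v (A v)))" if b: "b \<in> B" for b
  proof -
    have "inner b (A b) = (\<Sum>v\<in>eigvecs A. inner v b * inner v (A b))" by (rule parseval[OF oA, symmetric])
    also have "\<dots> = (\<Sum>v\<in>eigvecs A. (inner v b)\<^sup>2 *\<^sub>R inner v (A v))"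
      by (intro sum.cong refl) (simp add: inner_eigvecs_apply[OF A, of _ b] power2_eq_square)
    finally have e: "inner b (A b) = \<dots>" .
    show ?thesis unfolding e
      using B(3)[OF b] parseval_norm[OF oA, of b]
      by (intro convex_on_sum[OF fin ne conv]) auto
  qed
  then have "(\<Sum>b\<in>B. \<phi> (inner b (A b))) \<le> (\<Sum>b\<in>B. \<Sum>v\<in>eigvecs A. (inner v b)\<^sup>2 * \<phi> (inner v (A v)))"
    by (rule sum_mono)
  also have "\<dots> = (\<Sum>v\<in>eigvecs A. (\<Sum>b\<in>B. (inner v b)\<^sup>2) * \<phi> (inner v (A v)))"
    by (subst sum.swap) (simp add: sum_distrib_right)
  also have "\<dots> \<le> (\<Sum>v\<in>eigvecs A. 1 * \<phi> (inner v (A v)))"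
  proof (intro sum_mono mult_right_mono nonneg)
    fix v assume "v \<in> eigvecs A"
    then have "norm v = 1" using oA by (simp add: orthonormal_basis_def)
    then show "(\<Sum>b\<in>B. (inner v b)\<^sup>2) \<le> 1" using bessel_inequality[OF B, of v] by simp
  qed
  finally show ?thesis by (simp add: ftrace_def)
qed

lemma ftrace_cosh_double:
  fixes A :: "'e::euclidean_space \<Rightarrow>\<^sub>L 'e"
  assumes "selfadjoint A"
  shows "ftrace (\<lambda>s. cosh (2 * \<theta> * s)) A = DIM('e) + 2 * ftrace (\<lambda>s. (sinh (\<theta> * s))\<^sup>2) A"
    and "ftrace (\<lambda>s. (cosh (\<theta> * s))\<^sup>2) A = DIM('e) + ftrace (\<lambda>s. (sinh (\<theta> * s))\<^sup>2) A"
  using orthonormal_basis_card[OF orthonormal_basis_eigvecs[OF assms]]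
  by (simp_all add: ftrace_def cosh_double_cosh mult.assoc cosh_square_eq sum.distrib sum_distrib_left)


section \<open>From the Poincare inequality to exponential moments\<close>

lemma variance_on_eq:
  assumes "(\<Sum>x\<in>S. \<mu> x) = 1"
  shows "variance_on S \<mu> f = (\<Sum>x\<in>S. \<mu> x * (f x)\<^sup>2) - (\<Sum>x\<in>S. \<mu> x * f x)\<^sup>2"
proof -
  define m where "m = (\<Sum>x\<in>S. \<mu> x * f x)"
  have "variance_on S \<mu> f = (\<Sum>x\<in>S. \<mu> x * (f x)\<^sup>2 - 2 * m * (\<mu> x * f x) + m\<^sup>2 * \<mu> x)"
    unfolding variance_on_def m_def[symmetric]
    by (intro sum.cong refl) (simp add: power2_eq_square algebra_simps)
  also have "\<dots> = (\<Sum>x\<in>S. \<mu> x * (f x)\<^sup>2) - 2 * m * m + m\<^sup>2"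
    by (simp add: sum.distrib sum_subtractf assms m_def flip: sum_distrib_left)
  finally show ?thesis by (simp add: m_def power2_eq_square)
qed

text \<open>The best approximation of \<open>h\<close> by a sum of functions of one variable is
  \<open>a y - a x\<close>. Expanding the squared remainder gives \<open>2 * A \<le> H\<close>, so
  the averaged variance \<open>H - A\<close> is at least half of the second moment. This allows a
  variance bound in \<open>x\<close> with \<open>y\<close> frozen, although the mean over
  \<open>x\<close> alone need not vanish.\<close>

lemma antisymmetric_second_moment_le:
  fixes h :: "'s \<Rightarrow> 's \<Rightarrow> real"
  assumes mu: "\<And>x. x \<in> S \<Longrightarrow> 0 \<le> \<mu> x" and one: "(\<Sum>x\<in>S. \<mu> x) = 1"
    and anti: "\<And>x y. x \<in> S \<Longrightarrow> y \<in> S \<Longrightarrow> h y x = - h x y"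
  shows "(\<Sum>y\<in>S. \<mu> y * (\<Sum>x\<in>S. \<mu> x * (h x y)\<^sup>2)) \<le>
    2 * (\<Sum>y\<in>S. \<mu> y * variance_on S \<mu> (\<lambda>x. h x y))"
proof -
  define a where "a y = (\<Sum>x\<in>S. \<mu> x * h x y)" for y
  define H where "H = (\<Sum>y\<in>S. \<mu> y * (\<Sum>x\<in>S. \<mu> x * (h x y)\<^sup>2))"
  define A where "A = (\<Sum>y\<in>S. \<mu> y * (a y)\<^sup>2)"
  define m where "m = (\<Sum>y\<in>S. \<mu> y * a y)"
  have inner: "(\<Sum>x\<in>S. \<mu> x * (h x y + a x - a y)\<^sup>2) =
      (\<Sum>x\<in>S. \<mu> x * (h x y)\<^sup>2) + A - (a y)\<^sup>2 - 2 * m * a y + 2 * (\<Sum>x\<in>S. \<mu> x * (h x y * a x))" for y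
  proof -
    have "(\<Sum>x\<in>S. \<mu> x * (h x y + a x - a y)\<^sup>2) =
       (\<Sum>x\<in>S. \<mu> x * (h x y)\<^sup>2 + \<mu> x * (a x)\<^sup>2 + (a y)\<^sup>2 * \<mu> x - 2 * a y * (\<mu> x * a x)
          - 2 * a y * (\<mu> x * h x y) + 2 * (\<mu> x * (h x y * a x)))"
      by (intro sum.cong refl) (simp add: power2_eq_square algebra_simps)
    also have "\<dots> = (\<Sum>x\<in>S. \<mu> x * (h x y)\<^sup>2) + A + (a y)\<^sup>2 * 1 - 2 * a y * m
          - 2 * a y * a y + 2 * (\<Sum>x\<in>S. \<mu> x * (h x y * a x))"
      unfolding sum.distrib sum_subtractf sum_distrib_left[symmetric] one
      by (simp add: A_def m_def a_def)
    finally show ?thesis by (simp add: power2_eq_square)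
  qed
  have cross: "(\<Sum>y\<in>S. \<mu> y * (\<Sum>x\<in>S. \<mu> x * (h x y * a x))) = - A"
  proof -
    have "(\<Sum>y\<in>S. \<mu> y * (\<Sum>x\<in>S. \<mu> x * (h x y * a x))) = (\<Sum>x\<in>S. \<Sum>y\<in>S. \<mu> y * (\<mu> x * (h x y * a x)))"
      unfolding sum_distrib_left by (rule sum.swap)
    also have "\<dots> = (\<Sum>x\<in>S. \<Sum>y\<in>S. - (\<mu> x * a x * (\<mu> y * h y x)))"
      by (intro sum.cong refl, subst anti) simp_all
    also have "\<dots> = (\<Sum>x\<in>S. - (\<mu> x * a x * a x))"
      by (simp add: a_def sum_negf flip: sum_distrib_left)
    finally show ?thesis by (simp add: A_def sum_negf power2_eq_square mult.assoc)
  qed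
  have "0 \<le> (\<Sum>y\<in>S. \<mu> y * (\<Sum>x\<in>S. \<mu> x * (h x y + a x - a y)\<^sup>2))"
    by (intro sum_nonneg mult_nonneg_nonneg mu) auto
  also have "\<dots> = (\<Sum>y\<in>S. \<mu> y * (\<Sum>x\<in>S. \<mu> x * (h x y)\<^sup>2) + A * \<mu> y - \<mu> y * (a y)\<^sup>2 - 2 * m * (\<mu> y * a y)
        + 2 * (\<mu> y * (\<Sum>x\<in>S. \<mu> x * (h x y * a x))))"
    unfolding inner by (intro sum.cong refl) (simp add: algebra_simps)
  also have "\<dots> = H + A * 1 - A - 2 * m * m + 2 * (- A)"
    unfolding sum.distrib sum_subtractf sum_distrib_left[symmetric] one cross
    by (simp add: A_def m_def H_def)
  \<comment> \<open>The term \<open>- 2 * m * m\<close> has the favourable sign, so \<open>m\<close>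
    need not be evaluated.\<close>
  finally have "2 * A \<le> H" using zero_le_square[of m] by linarith
  moreover have "(\<Sum>y\<in>S. \<mu> y * variance_on S \<mu> (\<lambda>x. h x y)) = H - A"
    unfolding variance_on_eq[OF one] H_def A_def a_def
    by (simp add: algebra_simps sum_subtractf)
  ultimately show ?thesis by (simp add: H_def)
qed

lemma hs_square_pairs:
  "hs_square T = (\<Sum>p\<in>Basis \<times> Basis. (inner (fst p) (T (snd p)))\<^sup>2)"
  by (simp add: hs_square_def sum.cartesian_product split_beta)

lemma sum_rotate:
  "(\<Sum>p\<in>P. \<Sum>x\<in>A. \<Sum>y\<in>B. f p x y) = (\<Sum>x\<in>A. \<Sum>y\<in>B. \<Sum>p\<in>P. f p x y)"
  by (subst sum.swap, intro sum.cong refl, rule sum.swap)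

text \<open>Hypotheses \<open>row\<close> and \<open>col\<close> say that both marginals of a move
  are at most \<open>\<mu>\<close>, so \<open>cosh\<close> terms at either end of the move are
  bounded by expectations under \<open>\<mu>\<close>. The condition on \<open>\<theta>\<close> then
  gives \<open>W \<le> V / 2\<close>, and with \<open>V = DIM('e) + W\<close> this bounds
  \<open>W\<close> by the dimension.\<close>

theorem expectation_ftrace_cosh_le:
  fixes F :: "'s \<Rightarrow> 'e::euclidean_space \<Rightarrow>\<^sub>L 'e"
  assumes fin: "finite S"
    and mu: "\<And>x. x \<in> S \<Longrightarrow> 0 \<le> \<mu> x" and one: "(\<Sum>x\<in>S. \<mu> x) = 1"
    and K: "\<And>x y. x \<in> S \<Longrightarrow> y \<in> S \<Longrightarrow> 0 \<le> \<mu> x * K x y"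
    and row: "\<And>x. x \<in> S \<Longrightarrow> (\<Sum>y\<in>S. \<mu> x * K x y) \<le> \<mu> x"
    and col: "\<And>y. y \<in> S \<Longrightarrow> (\<Sum>x\<in>S. \<mu> x * K x y) \<le> \<mu> y"
    and poincare: "\<And>f. c * variance_on S \<mu> f \<le> dirichlet_form S \<mu> K f"
    and sa: "\<And>x. x \<in> S \<Longrightarrow> selfadjoint (F x)"
    and mean: "(\<Sum>x\<in>S. \<mu> x *\<^sub>R F x) = 0"
    and step: "\<And>x y. x \<in> S \<Longrightarrow> y \<in> S \<Longrightarrow> \<mu> x * K x y \<noteq> 0 \<Longrightarrow> norm (F x - F y) \<le> r"
    and c: "0 < c" and \<theta>: "2 * (\<theta> * r)\<^sup>2 \<le> c"
  shows "(\<Sum>x\<in>S. \<mu> x * ftrace (\<lambda>s. cosh (2 * \<theta> * s)) (F x)) \<le> 3 * DIM('e)"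
proof -
  define sh where "sh = (\<lambda>s. sinh (\<theta> * s))"
  define cs where "cs = (\<lambda>s. (cosh (\<theta> * s))\<^sup>2)"
  define h where "h p x y = inner (fst p) (fcalc sh (F x - F y) (snd p))" for p :: "'e \<times> 'e" and x y
  define I where "I = (Basis \<times> Basis :: ('e \<times> 'e) set)"
  define W where "W = (\<Sum>y\<in>S. \<mu> y * (\<Sum>x\<in>S. \<mu> x * ftrace (\<lambda>s. (sh s)\<^sup>2) (F x - F y)))"
  define V where "V = (\<Sum>y\<in>S. \<mu> y * (\<Sum>x\<in>S. \<mu> x * ftrace cs (F x - F y)))"
  have sad: "selfadjoint (F x - F y)" if "x \<in> S" "y \<in> S" for x y
    using that by (intro selfadjoint_diff sa)
  have V: "V = DIM('e) + W"
  proof -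
    have "V = (\<Sum>y\<in>S. \<mu> y * (\<Sum>x\<in>S. \<mu> x * (DIM('e) + ftrace (\<lambda>s. (sh s)\<^sup>2) (F x - F y))))"
      unfolding V_def cs_def sh_def
      by (intro sum.cong refl arg_cong2[where f="(*)"] ftrace_cosh_double sad)
    then show ?thesis
      by (simp add: W_def distrib_left sum.distrib one flip: sum_distrib_left sum_distrib_right)
  qed
  have W: "W = (\<Sum>p\<in>I. \<Sum>y\<in>S. \<mu> y * (\<Sum>x\<in>S. \<mu> x * (h p x y)\<^sup>2))"
  proof -
    have "W = (\<Sum>y\<in>S. \<Sum>x\<in>S. \<mu> y * (\<mu> x * (\<Sum>p\<in>I. (h p x y)\<^sup>2)))"
      unfolding W_def sum_distrib_left I_def h_def hs_square_pairs[symmetric]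
      by (intro sum.cong refl) (simp add: hs_square_fcalc sad)
    also have "\<dots> = (\<Sum>p\<in>I. \<Sum>y\<in>S. \<Sum>x\<in>S. \<mu> y * (\<mu> x * (h p x y)\<^sup>2))"
      unfolding sum_distrib_left by (rule sum_rotate[symmetric])
    finally show ?thesis by (simp add: sum_distrib_left)
  qed
  have anti: "h p y x = - h p x y" if "p \<in> I" "x \<in> S" "y \<in> S" for p x y
    using fcalc_uminus[OF sad[OF that(2,3)], of sh "fst p" "snd p"] that(1)
    by (auto simp: h_def I_def sh_def)
  \<comment> \<open>One matrix entry at a time: the Poincare inequality is used in \<open>x\<close>
    with the second copy frozen. The factor 2 from antisymmetry cancels the 1/2 of the Dirichlet
    form.\<close>
  have le1: "c * (\<Sum>y\<in>S. \<mu> y * (\<Sum>x\<in>S. \<mu> x * (h p x y)\<^sup>2)) \<le>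
      (\<Sum>z\<in>S. \<mu> z * (\<Sum>x\<in>S. \<Sum>y\<in>S. \<mu> x * K x y * (h p y z - h p x z)\<^sup>2))" if p: "p \<in> I" for p
  proof -
    have "c * (\<Sum>y\<in>S. \<mu> y * (\<Sum>x\<in>S. \<mu> x * (h p x y)\<^sup>2)) \<le>
        c * (2 * (\<Sum>y\<in>S. \<mu> y * variance_on S \<mu> (\<lambda>x. h p x y)))"
      using c by (intro mult_left_mono antisymmetric_second_moment_le mu one anti p) auto
    also have "\<dots> = (\<Sum>y\<in>S. \<mu> y * (2 * (c * variance_on S \<mu> (\<lambda>x. h p x y))))"
      by (simp add: sum_distrib_left algebra_simps)
    also have "\<dots> \<le> (\<Sum>y\<in>S. \<mu> y * (2 * dirichlet_form S \<mu> K (\<lambda>x. h p x y)))"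
      by (intro sum_mono mult_left_mono poincare mu) auto
    finally show ?thesis by (simp add: dirichlet_form_def)
  qed
  define R where "R x y z = hs_square (\<lambda>v. fcalc sh (F y - F z) v - fcalc sh (F x - F z) v)" for x y z
  have R: "(\<Sum>p\<in>I. (h p y z - h p x z)\<^sup>2) = R x y z" for x y z
    by (simp add: R_def hs_square_pairs h_def I_def inner_diff_right)
  have "c * W \<le> (\<Sum>p\<in>I. \<Sum>z\<in>S. \<mu> z * (\<Sum>x\<in>S. \<Sum>y\<in>S. \<mu> x * K x y * (h p y z - h p x z)\<^sup>2))"
    unfolding W by (subst sum_distrib_left) (rule sum_mono, rule le1)
  \<comment> \<open>Adding up the squared entries reassembles a Hilbert-Schmidt norm, to which the
    operator inequality applies.\<close>
  also have "\<dots> = (\<Sum>z\<in>S. \<mu> z * (\<Sum>x\<in>S. \<Sum>y\<in>S. \<mu> x * K x y * R x y z))"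
    unfolding sum.swap[of _ S I] sum_distrib_left[symmetric] R ..
  also have "\<dots> \<le> (\<Sum>z\<in>S. \<mu> z * (\<Sum>x\<in>S. \<Sum>y\<in>S. \<mu> x * K x y *
      ((\<theta> * r)\<^sup>2 / 2 * (ftrace cs (F y - F z) + ftrace cs (F x - F z)))))"
  proof (intro sum_mono mult_left_mono[OF _ mu])
    fix x y z assume S: "x \<in> S" "y \<in> S" "z \<in> S"
    show "\<mu> x * K x y * R x y z \<le> \<mu> x * K x y *
      ((\<theta> * r)\<^sup>2 / 2 * (ftrace cs (F y - F z) + ftrace cs (F x - F z)))"
    proof (cases "\<mu> x * K x y = 0")
      case False
      have "norm ((F y - F z) - (F x - F z)) \<le> r"
        using step[OF S(1,2) False] by (simp add: norm_minus_commute)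
      from hs_square_sinh_diff_le[OF sad[OF S(2,3)] sad[OF S(1,3)] this, of \<theta>]
      have "R x y z \<le> (\<theta> * r)\<^sup>2 / 2 * (ftrace cs (F y - F z) + ftrace cs (F x - F z))"
        unfolding R_def sh_def cs_def .
      then show ?thesis by (intro mult_left_mono K S)
    qed (simp only: mult_zero_left order_refl)
  qed
  also have "\<dots> = (\<Sum>z\<in>S. \<mu> z * ((\<theta> * r)\<^sup>2 / 2 *
      ((\<Sum>y\<in>S. (\<Sum>x\<in>S. \<mu> x * K x y) * ftrace cs (F y - F z)) +
       (\<Sum>x\<in>S. (\<Sum>y\<in>S. \<mu> x * K x y) * ftrace cs (F x - F z)))))"
  proof (intro sum.cong refl arg_cong2[where f="(*)"])
    fix z
    have "(\<Sum>x\<in>S. \<Sum>y\<in>S. \<mu> x * K x y * ((\<theta> * r)\<^sup>2 / 2 * (ftrace cs (F y - F z) + ftrace cs (F x - F z)))) =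
      (\<theta> * r)\<^sup>2 / 2 * ((\<Sum>x\<in>S. \<Sum>y\<in>S. \<mu> x * K x y * ftrace cs (F y - F z)) +
        (\<Sum>x\<in>S. \<Sum>y\<in>S. \<mu> x * K x y * ftrace cs (F x - F z)))"
      unfolding sum.distrib[symmetric] sum_distrib_left
      by (intro sum.cong refl) (simp add: algebra_simps)
    moreover have "(\<Sum>x\<in>S. \<Sum>y\<in>S. \<mu> x * K x y * ftrace cs (F y - F z)) =
        (\<Sum>y\<in>S. (\<Sum>x\<in>S. \<mu> x * K x y) * ftrace cs (F y - F z))"
      unfolding sum_distrib_right by (rule sum.swap)
    ultimately show "(\<Sum>x\<in>S. \<Sum>y\<in>S. \<mu> x * K x y * ((\<theta> * r)\<^sup>2 / 2 * (ftrace cs (F y - F z) + ftrace cs (F x - F z)))) =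
      (\<theta> * r)\<^sup>2 / 2 * ((\<Sum>y\<in>S. (\<Sum>x\<in>S. \<mu> x * K x y) * ftrace cs (F y - F z)) +
       (\<Sum>x\<in>S. (\<Sum>y\<in>S. \<mu> x * K x y) * ftrace cs (F x - F z)))"
      by (simp add: sum_distrib_right)
  qed
  also have "\<dots> \<le> (\<Sum>z\<in>S. \<mu> z * ((\<theta> * r)\<^sup>2 / 2 *
      ((\<Sum>y\<in>S. \<mu> y * ftrace cs (F y - F z)) + (\<Sum>x\<in>S. \<mu> x * ftrace cs (F x - F z)))))"
    by (intro sum_mono mult_left_mono add_mono mult_right_mono row col mu)
      (auto simp: ftrace_def cs_def intro!: sum_nonneg)
  also have "\<dots> = (\<theta> * r)\<^sup>2 * V"
    by (simp add: V_def sum_distrib_left algebra_simps)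
  also have "\<dots> \<le> c / 2 * V"
  proof (rule mult_right_mono)
    show "(\<theta> * r)\<^sup>2 \<le> c / 2" using \<theta> by simp
    show "0 \<le> V" unfolding V_def ftrace_def cs_def
      by (intro sum_nonneg mult_nonneg_nonneg mu) auto
  qed
  finally have "c * W \<le> c * (V / 2)" by simp
  then have "W \<le> V / 2" using c by simp
  then have Wle: "W \<le> DIM('e)" by (simp add: V)

  define ch where "ch = (\<lambda>s. cosh (2 * \<theta> * s))"
  have ne: "S \<noteq> {}" using one by auto
  \<comment> \<open>As \<open>F\<close> has mean zero, a diagonal entry of \<open>F x\<close> is the
    average over \<open>y\<close> of those of \<open>F x - F y\<close>. Scalar Jensen is applied in
    the eigenbasis of \<open>F x\<close>; Peierls' inequality then passes to the trace for
    \<open>F x - F y\<close>, whose eigenvectors are different.\<close>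
  have jensen: "ftrace ch (F x) \<le> (\<Sum>y\<in>S. \<mu> y * ftrace ch (F x - F y))" if x: "x \<in> S" for x
  proof -
    note ob = orthonormal_basis_eigvecs[OF sa[OF x]]
    have "ch (inner b (F x b)) \<le> (\<Sum>y\<in>S. \<mu> y * ch (inner b ((F x - F y) b)))" for b
    proof -
      have "inner b ((\<Sum>y\<in>S. \<mu> y *\<^sub>R F y) b) = 0" by (simp add: mean)
      then have "(\<Sum>y\<in>S. \<mu> y * inner b (F y b)) = 0"
        by (simp add: blinfun.sum_left blinfun.scaleR_left inner_sum_right)
      then have "inner b (F x b) = (\<Sum>y\<in>S. \<mu> y *\<^sub>R inner b ((F x - F y) b))"
        by (simp add: blinfun.diff_left inner_diff_right right_diff_distrib sum_subtractf one
            flip: sum_distrib_right)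
      then show ?thesis
        using convex_on_sum[OF fin ne convex_on_cosh one mu, of "\<lambda>y. inner b ((F x - F y) b)" "2 * \<theta>"]
        by (simp add: ch_def)
    qed
    then have "ftrace ch (F x) \<le> (\<Sum>b\<in>eigvecs (F x). \<Sum>y\<in>S. \<mu> y * ch (inner b ((F x - F y) b)))"
      unfolding ftrace_def by (rule sum_mono)
    also have "\<dots> = (\<Sum>y\<in>S. \<mu> y * (\<Sum>b\<in>eigvecs (F x). ch (inner b ((F x - F y) b))))"
      unfolding sum_distrib_left by (rule sum.swap)
    also have "\<dots> \<le> (\<Sum>y\<in>S. \<mu> y * ftrace ch (F x - F y))"
    proof (intro sum_mono mult_left_mono mu)
      fix y assume "y \<in> S"
      then show "(\<Sum>b\<in>eigvecs (F x). ch (inner b ((F x - F y) b))) \<le> ftrace ch (F x - F y)"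
        using ob unfolding ch_def
        by (intro peierls_inequality sad x convex_on_cosh) (auto simp: orthonormal_basis_def)
    qed
    finally show ?thesis .
  qed
  have "(\<Sum>x\<in>S. \<mu> x * ftrace ch (F x)) \<le> (\<Sum>x\<in>S. \<mu> x * (\<Sum>y\<in>S. \<mu> y * ftrace ch (F x - F y)))"
    by (intro sum_mono mult_left_mono jensen mu)
  also have "\<dots> = (\<Sum>y\<in>S. \<mu> y * (\<Sum>x\<in>S. \<mu> x * ftrace ch (F x - F y)))"
    unfolding sum_distrib_left by (subst sum.swap) (simp add: mult.left_commute)
  also have "\<dots> = (\<Sum>y\<in>S. \<mu> y * (\<Sum>x\<in>S. \<mu> x * (DIM('e) + 2 * ftrace (\<lambda>s. (sh s)\<^sup>2) (F x - F y))))"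
    unfolding ch_def sh_def
    by (intro sum.cong refl arg_cong2[where f="(*)"] ftrace_cosh_double sad)
  also have "\<dots> = DIM('e) + 2 * W"
    by (simp add: W_def distrib_left sum.distrib one mult.left_commute[of _ 2]
        flip: sum_distrib_left sum_distrib_right)
  finally show ?thesis using Wle by (simp add: ch_def)
qed


section \<open>Paths and counts\<close>

lemma finite_paths: "finite (paths n :: (nat \<Rightarrow> 'a::finite) set)"
  unfolding paths_def by (intro finite_PiE) auto

lemma sum_paths_Suc:
  fixes G :: "(nat \<Rightarrow> 'a::finite) \<Rightarrow> 'b::comm_monoid_add"
  shows "(\<Sum>w\<in>paths (Suc n). G w) = (\<Sum>u\<in>paths n. \<Sum>z\<in>UNIV. G (u(Suc n := z)))"
proof -
  have ins: "{1..Suc n} = insert (Suc n) {1..n}" by auto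
  have "(\<Sum>w\<in>paths (Suc n). G w) =
      sum G ((\<lambda>(y, g). g(Suc n := y)) ` (UNIV \<times> ({1..n} \<rightarrow>\<^sub>E UNIV)))"
    unfolding paths_def ins PiE_insert_eq ..
  also have "\<dots> = (\<Sum>(z, u)\<in>UNIV \<times> ({1..n} \<rightarrow>\<^sub>E UNIV). G (u(Suc n := z)))"
    by (subst sum.reindex) (auto intro!: inj_combinator simp: split_beta)
  also have "\<dots> = (\<Sum>z\<in>UNIV. \<Sum>u\<in>paths n. G (u(Suc n := z)))"
    unfolding paths_def by (rule sum.cartesian_product[symmetric])
  finally show ?thesis by (subst sum.swap)
qed

lemma path_law_nonneg:
  assumes "markov_kernel p" "stationary p \<pi>"
  shows "0 \<le> path_law p \<pi> n u"
  using assms by (auto simp: path_law_def markov_kernel_def stationary_def intro!: mult_nonneg_nonneg prod_nonneg)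

lemma path_law_Suc:
  assumes "1 \<le> n"
  shows "path_law p \<pi> (Suc n) (u(Suc n := z)) = path_law p \<pi> n u * p (u n) z"
proof -
  obtain m where n: "n = Suc m" using assms by (cases n) auto
  have "(\<Prod>i = 1..m. p ((u(Suc n := z)) i) ((u(Suc n := z)) (i + 1))) = (\<Prod>i = 1..m. p (u i) (u (i + 1)))"
    by (rule prod.cong) (auto simp: n)
  then show ?thesis by (simp add: path_law_def n)
qed

section \<open>Sliding the window and stationarity of the path law\<close>

text \<open>The window after one step: \<open>u 1\<close> is dropped, \<open>z\<close> is appended
  and indices move down by one. The restriction to \<open>{1..n}\<close> keeps the result
  extensional, hence in \<open>paths n\<close>.\<close>

definition slide :: "nat \<Rightarrow> (nat \<Rightarrow> 'a) \<Rightarrow> 'a \<Rightarrow> nat \<Rightarrow> 'a" where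
  "slide n u z = (\<lambda>i\<in>{1..n}. (u(Suc n := z)) (Suc i))"

text \<open>The pair \<open>(u, z)\<close> is a path of length n + 1 and corresponds bijectively to
  its first state and the slid window. Summing out the first state uses stationarity of \<pi>.
  Values in a vector space cover indicators and matrix means alike.\<close>

lemma sum_path_law_slide:
  fixes \<phi> :: "(nat \<Rightarrow> 'a::finite) \<Rightarrow> 'b::real_vector"
  assumes st: "stationary p \<pi>" and n: "1 \<le> n"
  shows "(\<Sum>u\<in>paths n. \<Sum>z\<in>UNIV. (path_law p \<pi> n u * p (u n) z) *\<^sub>R \<phi> (slide n u z)) =
    (\<Sum>w\<in>paths n. path_law p \<pi> n w *\<^sub>R \<phi> w)"
proof -
  define pr where "pr w = (\<Prod>i = 1..n - 1. p (w i) (w (i + 1)))" for w :: "nat \<Rightarrow> 'a"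
  \<comment> \<open>The inverse map: the dropped state goes back in front and the last state is
    split off.\<close>
  define unslide where "unslide = (\<lambda>(a, w). (\<lambda>i\<in>{1..n}. if i = 1 then a else w (i - 1), w n :: 'a))"
  have weight: "path_law p \<pi> n u * p (u n) z =
      \<pi> (u 1) * p (u 1) (slide n u z 1) * pr (slide n u z)" for u z
  proof -
    define v where "v = u(Suc n := z)"
    obtain m where m: "n = Suc m" using n by (cases n) auto
    have "path_law p \<pi> n u * p (u n) z = \<pi> (v 1) * (\<Prod>i = 1..n. p (v i) (v (i + 1)))"
      using path_law_Suc[OF n, of p \<pi> u z] by (simp add: path_law_def v_def)
    also have "(\<Prod>i = 1..n. p (v i) (v (i + 1))) =
        p (v 1) (v 2) * (\<Prod>i = Suc 1..n. p (v i) (v (i + 1)))"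
      using n by (subst prod.atLeast_Suc_atMost) (auto simp: numeral_2_eq_2)
    also have "(\<Prod>i = Suc 1..n. p (v i) (v (i + 1))) = (\<Prod>i = 1..m. p (v (Suc i)) (v (Suc i + 1)))"
      unfolding m by (rule prod.shift_bounds_cl_Suc_ivl)
    also have "\<dots> = pr (slide n u z)"
      unfolding pr_def slide_def m by (intro prod.cong) (auto simp: v_def m)
    also have "v 1 = u 1" using n by (simp add: v_def)
    also have "v 2 = slide n u z 1" using n by (simp add: slide_def v_def numeral_2_eq_2)
    finally show ?thesis by (simp add: mult.assoc)
  qed
  have "(\<Sum>u\<in>paths n. \<Sum>z\<in>UNIV. (path_law p \<pi> n u * p (u n) z) *\<^sub>R \<phi> (slide n u z)) =
    (\<Sum>(u, z)\<in>paths n \<times> UNIV. (\<pi> (u 1) * p (u 1) (slide n u z 1) * pr (slide n u z)) *\<^sub>R \<phi> (slide n u z))"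
    unfolding weight by (rule sum.cartesian_product)
  also have "\<dots> = (\<Sum>(a, w)\<in>UNIV \<times> paths n. (\<pi> a * p a (w 1) * pr w) *\<^sub>R \<phi> w)"
  proof (rule sum.reindex_bij_witness[where i = unslide and j = "\<lambda>(u, z). (u 1, slide n u z)"])
    show "unslide (case x of (u, z) \<Rightarrow> (u 1, slide n u z)) = x" if "x \<in> paths n \<times> UNIV" for x
      using that n by (auto simp: unslide_def slide_def paths_def PiE_def extensional_def fun_eq_iff)
    show "(case unslide y of (u, z) \<Rightarrow> (u 1, slide n u z)) = y" if "y \<in> UNIV \<times> paths n" for y
      using that n by (auto simp: unslide_def slide_def paths_def PiE_def extensional_def fun_eq_iff)
  qed (auto simp: unslide_def slide_def paths_def)
  also have "\<dots> = (\<Sum>w\<in>paths n. \<Sum>a\<in>UNIV. (\<pi> a * p a (w 1) * pr w) *\<^sub>R \<phi> w)"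
    by (subst sum.cartesian_product[symmetric], rule sum.swap)
  also have "\<dots> = (\<Sum>w\<in>paths n. path_law p \<pi> n w *\<^sub>R \<phi> w)"
  proof (rule sum.cong)
    fix w
    have "(\<Sum>a\<in>UNIV. \<pi> a * p a (w 1) * pr w) = path_law p \<pi> n w"
      using st unfolding sum_distrib_right[symmetric] by (simp add: stationary_def path_law_def pr_def)
    then show "(\<Sum>a\<in>UNIV. (\<pi> a * p a (w 1) * pr w) *\<^sub>R \<phi> w) = path_law p \<pi> n w *\<^sub>R \<phi> w"
      by (simp flip: scaleR_sum_left)
  qed simp
  finally show ?thesis .
qed

lemma sum_path_law_first:
  fixes G :: "'a::finite \<Rightarrow> 'b::real_vector"
  assumes mk: "markov_kernel p" and n: "1 \<le> n"
  shows "(\<Sum>u\<in>paths n. path_law p \<pi> n u *\<^sub>R G (u 1)) = mean \<pi> G"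
  using n
proof (induction n rule: dec_induct)
  case base
  \<comment> \<open>The only path of length 0 is undefined everywhere, so a path of length 1 amounts
    to its single state.\<close>
  have "paths 0 = {\<lambda>_. undefined :: 'a}" by (simp add: paths_def)
  then have "(\<Sum>u\<in>paths (Suc 0). path_law p \<pi> (Suc 0) u *\<^sub>R G (u 1)) = mean \<pi> G"
    unfolding sum_paths_Suc by (simp add: mean_def path_law_def)
  then show ?case by simp
next
  case (step n)
  have "(\<Sum>u\<in>paths (Suc n). path_law p \<pi> (Suc n) u *\<^sub>R G (u 1)) =
      (\<Sum>u\<in>paths n. \<Sum>z\<in>UNIV. p (u n) z *\<^sub>R (path_law p \<pi> n u *\<^sub>R G (u 1)))"
    unfolding sum_paths_Suc path_law_Suc[OF step(1)] using step(1)
    by (intro sum.cong) (auto simp: mult.commute)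
  also have "\<dots> = (\<Sum>u\<in>paths n. path_law p \<pi> n u *\<^sub>R G (u 1))"
    using mk by (simp only: scaleR_sum_left[symmetric] markov_kernel_def) simp
  finally show ?case using step.IH by simp
qed

text \<open>Coordinate \<open>i\<close> of the slid window is coordinate \<open>Suc i\<close> of the
  old one, so invariance under sliding carries the law of the first state to every later
  one.\<close>

lemma sum_path_law_coordinate:
  fixes G :: "'a::finite \<Rightarrow> 'b::real_vector"
  assumes mk: "markov_kernel p" and st: "stationary p \<pi>" and i: "1 \<le> i" "i \<le> n"
  shows "(\<Sum>u\<in>paths n. path_law p \<pi> n u *\<^sub>R G (u i)) = mean \<pi> G"
  using i
proof (induction i rule: dec_induct)
  case base
  then show ?case using sum_path_law_first[OF mk] by simp
next
  case (step i)
  have n: "1 \<le> n" using step by simp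
  have "mean \<pi> G = (\<Sum>u\<in>paths n. path_law p \<pi> n u *\<^sub>R G (u i))" using step by simp
  also have "\<dots> = (\<Sum>u\<in>paths n. \<Sum>z\<in>UNIV. p (u n) z *\<^sub>R (path_law p \<pi> n u *\<^sub>R G (u (Suc i))))"
    unfolding sum_path_law_slide[OF st n, symmetric] using step
    by (intro sum.cong) (auto simp: slide_def mult.commute)
  also have "\<dots> = (\<Sum>u\<in>paths n. path_law p \<pi> n u *\<^sub>R G (u (Suc i)))"
    using mk by (simp only: scaleR_sum_left[symmetric] markov_kernel_def) simp
  finally show ?case by simp
qed

lemma sum_path_law:
  assumes "markov_kernel p" and st: "stationary p \<pi>" and "1 \<le> n"
  shows "(\<Sum>u\<in>paths n. path_law p \<pi> n u) = 1"
  using sum_path_law_first[OF assms(1,3), of \<pi> "\<lambda>_. 1 :: real"] st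
  by (simp add: mean_def stationary_def)

section \<open>Count vectors and their law\<close>

lemma counts_eq_sum: "counts n u x = (\<Sum>i = 1..n. if u i = x then 1 else 0)"
  unfolding counts_def by (simp add: sum.If_cases) (auto intro!: arg_cong[where f=card])

text \<open>This identifies the move in the definition of \<open>count_kernel\<close> with sliding:
  both windows are parts of one path of length n + 1, and only its end states are not
  shared.\<close>

lemma counts_slide:
  assumes n: "1 \<le> n"
  shows "counts n (slide n u z) = (\<lambda>x. counts n u x - unit_count (u 1) x + unit_count z x)"
proof
  fix x
  define v where "v = u(Suc n := z)"
  define f where "f i = (if v i = x then 1 else 0 :: nat)" for i
  have "counts n (slide n u z) x = (\<Sum>i = 1..n. f (Suc i))"
    unfolding counts_eq_sum slide_def f_def v_def by (rule sum.cong) auto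
  moreover have "f 1 + (\<Sum>i = 1..n. f (Suc i)) = (\<Sum>i = 1..n. f i) + f (Suc n)"
  proof -
    have "f 1 + (\<Sum>i = 1..n. f (Suc i)) = f 1 + (\<Sum>i = Suc 1..Suc n. f i)"
      by (simp only: sum.shift_bounds_cl_Suc_ivl)
    also have "\<dots> = (\<Sum>i = 1..Suc n. f i)"
      by (rule sum.atLeast_Suc_atMost[symmetric]) simp
    finally show ?thesis by simp
  qed
  moreover have "counts n u x = (\<Sum>i = 1..n. f i)"
    unfolding counts_eq_sum f_def v_def by (rule sum.cong) auto
  moreover have "f 1 = unit_count (u 1) x" "f (Suc n) = unit_count z x"
    using n by (auto simp: f_def v_def unit_count_def)
  \<comment> \<open>The first state is counted in the window, so the subtraction on
    \<open>nat\<close> does not truncate.\<close>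
  moreover have "f 1 \<le> (\<Sum>i = 1..n. f i)" using n by (intro member_le_sum) auto
  ultimately show "counts n (slide n u z) x = counts n u x - unit_count (u 1) x + unit_count z x"
    by linarith
qed

text \<open>This makes the empirical mean a function of the counts, and so a function on the state
  space of the count kernel.\<close>

lemma sum_counts:
  fixes g :: "'a::finite \<Rightarrow> 'b::real_vector"
  shows "(\<Sum>x\<in>UNIV. real (counts n u x) *\<^sub>R g x) = (\<Sum>i = 1..n. g (u i))"
proof -
  have "(\<Sum>x\<in>UNIV. real (counts n u x) *\<^sub>R g x) =
      (\<Sum>x\<in>UNIV. \<Sum>i = 1..n. if u i = x then g x else 0)"
    unfolding counts_eq_sum of_nat_sum scaleR_sum_left by (intro sum.cong) auto
  also have "\<dots> = (\<Sum>i = 1..n. g (u i))" by (subst sum.swap) simp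
  finally show ?thesis .
qed

lemma counts_in_count_space: "counts n u \<in> count_space_n n"
  unfolding count_space_n_def mem_Collect_eq counts_eq_sum by (subst sum.swap) simp

lemma finite_count_supp: "finite (count_supp p \<pi> n)"
proof (rule finite_subset)
  show "count_supp p \<pi> n \<subseteq> counts n ` paths n"
  proof
    fix \<eta> assume "\<eta> \<in> count_supp p \<pi> n"
    then have "count_law p \<pi> n \<eta> \<noteq> 0" by (simp add: count_supp_def)
    then have "{u. u \<in> paths n \<and> counts n u = \<eta>} \<noteq> {}"
      unfolding count_law_def by (metis sum.empty)
    then show "\<eta> \<in> counts n ` paths n" by auto
  qed
qed (simp add: finite_paths)

lemma count_law_nonneg:
  assumes "markov_kernel p" "stationary p \<pi>"
  shows "0 \<le> count_law p \<pi> n \<eta>"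
  unfolding count_law_def by (intro sum_nonneg path_law_nonneg assms)

text \<open>A fibre outside the support has total weight zero, so by nonnegativity each of its paths
  has weight zero and restricting to the support loses nothing.\<close>

lemma sum_over_count_fibres:
  fixes G :: "(nat \<Rightarrow> 'a::finite) \<Rightarrow> 'b::real_vector"
  assumes mk: "markov_kernel p" and st: "stationary p \<pi>"
  shows "(\<Sum>\<eta>\<in>count_supp p \<pi> n. \<Sum>u | u \<in> paths n \<and> counts n u = \<eta>. path_law p \<pi> n u *\<^sub>R G u) =
    (\<Sum>u\<in>paths n. path_law p \<pi> n u *\<^sub>R G u)"
proof -
  define T where "T \<eta> = {u. u \<in> paths n \<and> counts n u = \<eta>}" for \<eta> :: "'a \<Rightarrow> nat"
  have zero: "path_law p \<pi> n u = 0" if u: "u \<in> T \<eta>" and \<eta>: "\<eta> \<notin> count_supp p \<pi> n" for u \<eta>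
  proof -
    have "count_law p \<pi> n \<eta> = 0"
      using u \<eta> count_law_nonneg[OF mk st, of n \<eta>] counts_in_count_space[of n u]
      by (auto simp: T_def count_supp_def)
    then show ?thesis
      using u path_law_nonneg[OF mk st, of n]
      by (subst (asm) count_law_def, subst (asm) sum_nonneg_eq_0_iff)
        (auto simp: T_def finite_paths)
  qed
  have "(\<Sum>u\<in>paths n. path_law p \<pi> n u *\<^sub>R G u) =
      (\<Sum>\<eta>\<in>counts n ` paths n. \<Sum>u\<in>T \<eta>. path_law p \<pi> n u *\<^sub>R G u)"
    unfolding T_def by (rule sum.image_gen[OF finite_paths])
  \<comment> \<open>Both index sets are compared with their union: vectors added here have empty
    fibres, those removed next have fibres of weight zero.\<close>
  also have "\<dots> = (\<Sum>\<eta>\<in>counts n ` paths n \<union> count_supp p \<pi> n. \<Sum>u\<in>T \<eta>. path_law p \<pi> n u *\<^sub>R G u)"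
    by (rule sum.mono_neutral_left) (auto simp: finite_paths finite_count_supp T_def intro!: sum.neutral)
  also have "\<dots> = (\<Sum>\<eta>\<in>count_supp p \<pi> n. \<Sum>u\<in>T \<eta>. path_law p \<pi> n u *\<^sub>R G u)"
    by (rule sum.mono_neutral_right) (auto simp: finite_paths finite_count_supp zero intro!: sum.neutral)
  finally show ?thesis by (simp add: T_def)
qed

lemma sum_count_law:
  fixes \<phi> :: "('a::finite \<Rightarrow> nat) \<Rightarrow> 'b::real_vector"
  assumes "markov_kernel p" "stationary p \<pi>"
  shows "(\<Sum>\<eta>\<in>count_supp p \<pi> n. count_law p \<pi> n \<eta> *\<^sub>R \<phi> \<eta>) =
    (\<Sum>u\<in>paths n. path_law p \<pi> n u *\<^sub>R \<phi> (counts n u))"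
  unfolding sum_over_count_fibres[OF assms, symmetric]
  by (simp add: count_law_def scaleR_sum_left)

section \<open>The count kernel as a flow between count vectors\<close>

text \<open>The conditional probability, given the window \<open>u\<close>, that the next window has
  counts \<xi>.\<close>

definition flow :: "('a::finite \<Rightarrow> 'a \<Rightarrow> real) \<Rightarrow> nat \<Rightarrow> ('a \<Rightarrow> nat) \<Rightarrow> (nat \<Rightarrow> 'a) \<Rightarrow> real" where
  "flow p n \<xi> u = (\<Sum>z\<in>UNIV. p (u n) z * (if counts n (slide n u z) = \<xi> then 1 else 0))"

text \<open>On the support the normalisation of the kernel cancels, which leaves a plain sum over
  paths.\<close>

lemma count_law_kernel:
  assumes \<eta>: "\<eta> \<in> count_supp p \<pi> n" and n: "1 \<le> n"
  shows "count_law p \<pi> n \<eta> * count_kernel p \<pi> n \<eta> \<xi> =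
    (\<Sum>u | u \<in> paths n \<and> counts n u = \<eta>. path_law p \<pi> n u * flow p n \<xi> u)"
proof -
  have "count_law p \<pi> n \<eta> \<noteq> 0" using \<eta> by (simp add: count_supp_def)
  then have "count_law p \<pi> n \<eta> * count_kernel p \<pi> n \<eta> \<xi> =
    (\<Sum>u | u \<in> paths n \<and> counts n u = \<eta>. path_law p \<pi> n u *
        (\<Sum>z\<in>UNIV. p (u n) z *
           (if (\<lambda>x. \<eta> x - unit_count (u 1) x + unit_count z x) = \<xi> then 1 else 0)))"
    by (simp add: count_kernel_def)
  also have "\<dots> = (\<Sum>u | u \<in> paths n \<and> counts n u = \<eta>. path_law p \<pi> n u * flow p n \<xi> u)"
    unfolding flow_def counts_slide[OF n] by (intro sum.cong) auto
  finally show ?thesis .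
qed

lemma flow_nonneg: "markov_kernel p \<Longrightarrow> 0 \<le> flow p n \<xi> u"
  by (auto simp: flow_def markov_kernel_def intro!: sum_nonneg)

text \<open>Each \<open>z\<close> leads to a single count vector, which may or may not lie in
  \<open>S\<close>.\<close>

lemma sum_flow_le:
  assumes "markov_kernel p" "finite S"
  shows "(\<Sum>\<xi>\<in>S. flow p n \<xi> u) \<le> 1"
proof -
  have "(\<Sum>\<xi>\<in>S. flow p n \<xi> u) =
      (\<Sum>z\<in>UNIV. p (u n) z * (\<Sum>\<xi>\<in>S. if counts n (slide n u z) = \<xi> then 1 else 0))"
    unfolding flow_def sum_distrib_left by (rule sum.swap)
  also have "\<dots> \<le> (\<Sum>z\<in>UNIV. p (u n) z * 1)"
    using assms by (intro sum_mono mult_left_mono) (auto simp: markov_kernel_def)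
  finally show ?thesis using assms by (simp add: markov_kernel_def)
qed

lemma count_flow_nonneg:
  assumes "markov_kernel p" "stationary p \<pi>" "1 \<le> n" "\<eta> \<in> count_supp p \<pi> n"
  shows "0 \<le> count_law p \<pi> n \<eta> * count_kernel p \<pi> n \<eta> \<xi>"
  unfolding count_law_kernel[OF assms(4,3)]
  by (intro sum_nonneg mult_nonneg_nonneg path_law_nonneg flow_nonneg assms)

lemma count_flow_row:
  assumes "markov_kernel p" "stationary p \<pi>" "1 \<le> n" "\<eta> \<in> count_supp p \<pi> n"
  shows "(\<Sum>\<xi>\<in>count_supp p \<pi> n. count_law p \<pi> n \<eta> * count_kernel p \<pi> n \<eta> \<xi>) \<le> count_law p \<pi> n \<eta>"
proof -
  have "(\<Sum>\<xi>\<in>count_supp p \<pi> n. count_law p \<pi> n \<eta> * count_kernel p \<pi> n \<eta> \<xi>) =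
    (\<Sum>u | u \<in> paths n \<and> counts n u = \<eta>. path_law p \<pi> n u * (\<Sum>\<xi>\<in>count_supp p \<pi> n. flow p n \<xi> u))"
    unfolding count_law_kernel[OF assms(4,3)] sum_distrib_left by (rule sum.swap)
  also have "\<dots> \<le> (\<Sum>u | u \<in> paths n \<and> counts n u = \<eta>. path_law p \<pi> n u * 1)"
    by (intro sum_mono mult_left_mono sum_flow_le path_law_nonneg finite_count_supp assms)
  finally show ?thesis by (simp add: count_law_def)
qed

text \<open>Invariance of the count law: the fibres together make up all paths, and the path law is
  preserved by sliding, here tested on the indicator of counts \<xi>.\<close>

lemma count_flow_col:
  assumes "markov_kernel p" "stationary p \<pi>" "1 \<le> n"
  shows "(\<Sum>\<eta>\<in>count_supp p \<pi> n. count_law p \<pi> n \<eta> * count_kernel p \<pi> n \<eta> \<xi>) = count_law p \<pi> n \<xi>"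
proof -
  have "(\<Sum>\<eta>\<in>count_supp p \<pi> n. count_law p \<pi> n \<eta> * count_kernel p \<pi> n \<eta> \<xi>) =
    (\<Sum>u\<in>paths n. path_law p \<pi> n u *\<^sub>R flow p n \<xi> u)"
    unfolding sum_over_count_fibres[OF assms(1,2), symmetric]
    by (intro sum.cong refl) (simp add: count_law_kernel[OF _ assms(3)])
  also have "\<dots> = (\<Sum>w\<in>paths n. path_law p \<pi> n w *\<^sub>R (if counts n w = \<xi> then 1 else 0))"
    unfolding flow_def
      sum_path_law_slide[OF assms(2,3), where \<phi>="\<lambda>w. if counts n w = \<xi> then 1 else 0", symmetric]
    by (simp add: sum_distrib_left mult.assoc)
  also have "\<dots> = count_law p \<pi> n \<xi>"
    unfolding count_law_def
    by (simp add: sum.If_cases finite_paths if_distrib Int_def cong: if_cong)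
  finally show ?thesis .
qed

text \<open>A nonzero flow is witnessed by some window \<open>u\<close> and new state
  \<open>z\<close>; the two windows share all states except \<open>u 1\<close> and
  \<open>z\<close>.\<close>

lemma count_step:
  fixes g :: "'a::finite \<Rightarrow> 'b::real_vector"
  assumes "count_law p \<pi> n \<eta> * count_kernel p \<pi> n \<eta> \<xi> \<noteq> 0" "\<eta> \<in> count_supp p \<pi> n" "1 \<le> n"
  obtains y z where
    "(\<Sum>x\<in>UNIV. real (\<eta> x) *\<^sub>R g x) - (\<Sum>x\<in>UNIV. real (\<xi> x) *\<^sub>R g x) = g y - g z"
proof -
  from assms(1) obtain u where u: "u \<in> paths n" "counts n u = \<eta>" and "flow p n \<xi> u \<noteq> 0"
    unfolding count_law_kernel[OF assms(2,3)] by (force dest: sum.not_neutral_contains_not_neutral)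
  then obtain z where z: "counts n (slide n u z) = \<xi>"
    unfolding flow_def by (force dest: sum.not_neutral_contains_not_neutral split: if_splits)
  obtain m where m: "n = Suc m" using assms(3) by (cases n) auto
  have "(\<Sum>x\<in>UNIV. real (\<xi> x) *\<^sub>R g x) = (\<Sum>i = 1..n. g ((u(Suc n := z)) (Suc i)))"
    unfolding z[symmetric] sum_counts slide_def by (intro sum.cong) auto
  also have "\<dots> = (\<Sum>i = 1..m. g (u (Suc i))) + g z"
    unfolding m by simp
  also have "(\<Sum>i = 1..m. g (u (Suc i))) = (\<Sum>i = Suc 1..Suc m. g (u i))"
    by (rule sum.shift_bounds_cl_Suc_ivl[symmetric])
  finally have "(\<Sum>x\<in>UNIV. real (\<xi> x) *\<^sub>R g x) = (\<Sum>i = Suc 1..n. g (u i)) + g z" by (simp add: m)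
  moreover have "(\<Sum>x\<in>UNIV. real (\<eta> x) *\<^sub>R g x) = g (u 1) + (\<Sum>i = Suc 1..n. g (u i))"
    unfolding u(2)[symmetric] sum_counts using assms(3) by (intro sum.atLeast_Suc_atMost)
  ultimately show ?thesis by (intro that[of "u 1" z]) simp
qed


section \<open>Hermitian matrices as real operators\<close>

text \<open>By Parseval in the eigenbasis, no vector is stretched by more than the largest absolute
  eigenvalue, which is attained because the basis is finite and nonempty.\<close>

lemma norm_le_abs_eigenvalue:
  fixes A :: "'e::euclidean_space \<Rightarrow>\<^sub>L 'e"
  assumes A: "selfadjoint A"
  obtains b where "b \<in> eigvecs A" "norm A \<le> \<bar>inner b (A b)\<bar>"
proof -
  note ob = orthonormal_basis_eigvecs[OF A]
  have fin: "finite (eigvecs A)" using ob by (simp add: orthonormal_basis_def)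
  have ne: "eigvecs A \<noteq> {}" using orthonormal_basis_card[OF ob] by auto
  define m where "m = Max ((\<lambda>b. \<bar>inner b (A b)\<bar>) ` eigvecs A)"
  have "m \<in> (\<lambda>b. \<bar>inner b (A b)\<bar>) ` eigvecs A" unfolding m_def using fin ne by (intro Max_in) auto
  then obtain b where b: "b \<in> eigvecs A" "m = \<bar>inner b (A b)\<bar>" by auto
  have m: "\<bar>inner c (A c)\<bar> \<le> m" if "c \<in> eigvecs A" for c
    unfolding m_def using fin that by (intro Max_ge) auto
  have "norm (A x) \<le> m * norm x" for x
  proof (rule power2_le_imp_le)
    have "(norm (A x))\<^sup>2 = (\<Sum>c\<in>eigvecs A. (inner c (A c))\<^sup>2 * (inner c x)\<^sup>2)"
      unfolding parseval_norm[OF ob, of "A x", symmetric]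
      by (intro sum.cong refl) (simp add: inner_eigvecs_apply[OF A, of _ x] power_mult_distrib)
    also have "\<dots> \<le> (\<Sum>c\<in>eigvecs A. m\<^sup>2 * (inner c x)\<^sup>2)"
    proof (intro sum_mono mult_right_mono)
      fix c assume "c \<in> eigvecs A"
      then show "(inner c (A c))\<^sup>2 \<le> m\<^sup>2" using m by (metis abs_ge_zero power2_abs power_mono)
    qed simp
    also have "\<dots> = (m * norm x)\<^sup>2"
      by (simp add: parseval_norm[OF ob] power_mult_distrib flip: sum_distrib_left)
    finally show "(norm (A x))\<^sup>2 \<le> (m * norm x)\<^sup>2" .
    show "0 \<le> m * norm x" using b by simp
  qed
  then have "norm A \<le> m" using b by (intro norm_blinfun_bound) auto
  then show ?thesis using b that by auto
qed

definition mat_op :: "complex ^ 'd ^ 'd \<Rightarrow> (complex ^ 'd) \<Rightarrow>\<^sub>L (complex ^ 'd)" where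
  "mat_op A = Blinfun (\<lambda>v. A *v v)"

lemma mat_op_apply: "blinfun_apply (mat_op A) = (\<lambda>v. A *v v)"
proof -
  have "linear (\<lambda>v. A *v v)"
    by (rule linearI)
      (auto simp: matrix_vector_right_distrib vec_eq_iff matrix_vector_mult_def scaleR_sum_right
        distrib_left sum.distrib)
  then show ?thesis
    unfolding mat_op_def by (simp add: bounded_linear_Blinfun_apply linear_conv_bounded_linear)
qed

lemma norm_mat_op: "norm (mat_op A) = op_norm A"
  by (simp add: norm_blinfun.rep_eq op_norm_def mat_op_apply)

lemma linear_mat_op: "linear mat_op"
  by (rule linearI; rule blinfun_eqI)
    (auto simp: mat_op_apply blinfun.add_left blinfun.scaleR_left matrix_vector_mult_def vec_eq_iff
      scaleR_sum_right sum.distrib distrib_right)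

lemma hermitian_cnj: "hermitian A \<Longrightarrow> cnj (A $ i $ j) = A $ j $ i"
  unfolding hermitian_def by metis

text \<open>The real inner product is the real part of the complex one, so an entry moves to the
  other side as its conjugate.\<close>

lemma selfadjoint_mat_op:
  assumes "hermitian A"
  shows "selfadjoint (mat_op A)"
proof -
  have cplx: "inner (a * x) y = inner x (cnj a * y)" for a x y :: complex
    by (simp add: inner_complex_def algebra_simps)
  have "inner (A *v x) y = inner x (A *v y)" for x y
  proof -
    have "inner (A *v x) y = (\<Sum>i\<in>UNIV. \<Sum>j\<in>UNIV. inner (x $ j) (cnj (A $ i $ j) * y $ i))"
      by (simp add: inner_vec_def matrix_vector_mult_def inner_sum_left cplx)
    also have "\<dots> = (\<Sum>j\<in>UNIV. \<Sum>i\<in>UNIV. inner (x $ j) (A $ j $ i * y $ i))"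
      by (subst sum.swap) (simp add: hermitian_cnj[OF assms])
    also have "\<dots> = inner x (A *v y)"
      by (simp add: inner_vec_def matrix_vector_mult_def inner_sum_right)
    finally show ?thesis .
  qed
  then show ?thesis by (simp add: selfadjoint_def mat_op_apply)
qed

text \<open>Seen as a real operator, a Hermitian matrix has every eigenvalue twice: along with an
  eigenvector \<open>b\<close> it has the eigenvector \<open>\<i> b\<close>, which is orthogonal to \<open>b\<close> for the real inner product.
  This absorbs the factor two between the real and the complex dimension.\<close>

lemma two_cosh_op_norm_le:
  fixes A :: "complex ^ 'd ^ 'd"
  assumes A: "hermitian A"
  shows "2 * cosh (k * op_norm A) \<le> ftrace (\<lambda>s. cosh (k * s)) (mat_op A)"
proof -
  note sa = selfadjoint_mat_op[OF A]
  obtain b where b: "b \<in> eigvecs (mat_op A)" "norm (mat_op A) \<le> \<bar>inner b (mat_op A b)\<bar>"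
    by (rule norm_le_abs_eigenvalue[OF sa])
  have nb: "norm b = 1"
    using orthonormal_basis_eigvecs[OF sa] b(1) by (auto simp: orthonormal_basis_def)
  \<comment> \<open>Multiplication by the imaginary unit: it is isometric, commutes with
    \<open>A\<close> and sends \<open>b\<close> to an orthogonal vector, so \<open>b\<close> and
    \<open>J b\<close> have the same Rayleigh quotient.\<close>
  define J where "J v = (\<chi> i. \<i> * v $ i)" for v :: "complex ^ 'd"
  have JJ: "inner (J x) (J y) = inner x y" for x y
    by (simp add: J_def inner_vec_def inner_complex_def algebra_simps)
  have AJ: "A *v J x = J (A *v x)" for x
    by (simp add: J_def matrix_vector_mult_def vec_eq_iff sum_distrib_left algebra_simps)
  have bJ: "inner b (J b) = 0"
    by (simp add: J_def inner_vec_def inner_complex_def algebra_simps)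
  have nJ: "norm (J b) = 1" using nb JJ[of b b] by (simp add: norm_eq_1)
  have neq: "b \<noteq> J b" using bJ nb by (metis inner_eq_zero_iff norm_zero zero_neq_one)
  have ev: "inner (J b) (mat_op A (J b)) = inner b (mat_op A b)"
    by (simp add: mat_op_apply AJ JJ)
  have "(\<Sum>v\<in>{b, J b}. cosh (k * inner v (mat_op A v))) \<le> ftrace (\<lambda>s. cosh (k * s)) (mat_op A)"
    using nb nJ bJ
    by (intro peierls_inequality[OF sa] convex_on_cosh)
      (auto simp: pairwise_def orthogonal_def inner_commute)
  then have "2 * cosh (k * inner b (mat_op A b)) \<le> ftrace (\<lambda>s. cosh (k * s)) (mat_op A)"
    using neq by (simp add: ev)
  \<comment> \<open>\<open>cosh\<close> is even, so only the absolute value of the extreme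
    eigenvalue matters.\<close>
  moreover have "cosh (k * op_norm A) \<le> cosh (k * inner b (mat_op A b))"
  proof -
    have "cosh \<bar>k * op_norm A\<bar> \<le> cosh \<bar>k * inner b (mat_op A b)\<bar>"
    proof (subst cosh_real_nonneg_le_iff)
      show "\<bar>k * op_norm A\<bar> \<le> \<bar>k * inner b (mat_op A b)\<bar>"
        using b(2) norm_ge_zero[of "mat_op A"] unfolding abs_mult norm_mat_op
        by (intro mult_left_mono) auto
    qed auto
    then show ?thesis by simp
  qed
  ultimately show ?thesis by linarith
qed

section \<open>The spectral gap as a Poincare constant\<close>

text \<open>Functions of zero variance do not enter the infimum, but for them the left side is at
  most zero. A real lower bound \<open>c\<close> replaces the gap itself, so that an infinite gap is
  covered.\<close>

lemma spectral_gap_poincare: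
  assumes c: "ereal c \<le> spectral_gap S \<rho> K" "0 \<le> c"
    and K: "\<And>x y. x \<in> S \<Longrightarrow> y \<in> S \<Longrightarrow> 0 \<le> \<rho> x * K x y"
  shows "c * variance_on S \<rho> f \<le> dirichlet_form S \<rho> K f"
proof (cases "0 < variance_on S \<rho> f")
  case True
  then have "spectral_gap S \<rho> K \<le> ereal (dirichlet_form S \<rho> K f / variance_on S \<rho> f)"
    unfolding spectral_gap_def by (intro INF_lower) simp
  with c(1) have "ereal c \<le> ereal (dirichlet_form S \<rho> K f / variance_on S \<rho> f)" by (rule order_trans)
  then show ?thesis using True by (simp add: field_simps)
next
  case False
  then have "c * variance_on S \<rho> f \<le> 0" using c(2) by (simp add: mult_nonneg_nonpos)
  also have "0 \<le> dirichlet_form S \<rho> K f"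
    unfolding dirichlet_form_def by (intro mult_nonneg_nonneg sum_nonneg K) auto
  finally show ?thesis .
qed

lemma spectral_gap_nonneg:
  assumes K: "\<And>x y. x \<in> S \<Longrightarrow> y \<in> S \<Longrightarrow> 0 \<le> \<rho> x * K x y"
  shows "0 \<le> spectral_gap S \<rho> K"
  unfolding spectral_gap_def dirichlet_form_def
  by (intro INF_greatest) (auto intro!: divide_nonneg_nonneg mult_nonneg_nonneg sum_nonneg K)

section \<open>Exponential moments of the deviation\<close>

definition deviation :: "('a::finite \<Rightarrow> real) \<Rightarrow> ('a \<Rightarrow> complex ^ 'd ^ 'd) \<Rightarrow> nat \<Rightarrow> (nat \<Rightarrow> 'a) \<Rightarrow> complex ^ 'd ^ 'd"
  where "deviation \<pi> g n u = (1 / real n) *\<^sub>R (\<Sum>i = 1..n. g (u i)) - mean \<pi> g"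

lemma hermitian_0: "hermitian 0"
  by (simp add: hermitian_def)

lemma hermitian_add: "hermitian A \<Longrightarrow> hermitian B \<Longrightarrow> hermitian (A + B)"
  unfolding hermitian_def[of "A + B"] by (simp add: hermitian_cnj)

lemma hermitian_diff: "hermitian A \<Longrightarrow> hermitian B \<Longrightarrow> hermitian (A - B)"
  unfolding hermitian_def[of "A - B"] by (simp add: hermitian_cnj)

lemma hermitian_scaleR: "hermitian A \<Longrightarrow> hermitian (r *\<^sub>R A)"
  unfolding hermitian_def[of "r *\<^sub>R A"] by (simp add: hermitian_cnj)

lemma hermitian_sum: "(\<And>i. i \<in> I \<Longrightarrow> hermitian (f i)) \<Longrightarrow> hermitian (sum f I)"
  by (induction I rule: infinite_finite_induct) (auto intro: hermitian_0 hermitian_add)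

text \<open>The abstract moment bound is applied to the count kernel and carried back to paths by
  \<open>sum_count_law\<close>. If the gap is infinite, \<open>c\<close> and hence \<open>k\<close>
  may be taken arbitrarily large.\<close>

theorem sum_path_law_cosh_deviation_le:
  fixes p :: "'a::finite \<Rightarrow> 'a \<Rightarrow> real" and g :: "'a \<Rightarrow> complex ^ 'd ^ 'd"
  assumes mk: "markov_kernel p" and st: "stationary p \<pi>" and n: "1 \<le> n"
    and g: "\<And>x. hermitian (g x)" "\<And>x. op_norm (g x) \<le> 1"
    and c: "0 < c" "ereal c \<le> count_gap p \<pi> n"
    and k: "2 * k\<^sup>2 \<le> (real n)\<^sup>2 * c"
  shows "(\<Sum>u\<in>paths n. path_law p \<pi> n u * cosh (k * op_norm (deviation \<pi> g n u))) \<le> 3 * CARD('d)"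
proof -
  define S where "S = count_supp p \<pi> n"
  define \<mu> where "\<mu> = count_law p \<pi> n"
  define K where "K = count_kernel p \<pi> n"
  define G where "G \<eta> = (1 / real n) *\<^sub>R (\<Sum>x\<in>UNIV. real (\<eta> x) *\<^sub>R g x) - mean \<pi> g" for \<eta> :: "'a \<Rightarrow> nat"
  define F where "F \<eta> = mat_op (G \<eta>)" for \<eta>
  have Gdev: "G (counts n u) = deviation \<pi> g n u" for u
    by (simp add: G_def deviation_def sum_counts)
  have hG: "hermitian (G \<eta>)" for \<eta>
    unfolding G_def mean_def by (intro hermitian_diff hermitian_scaleR hermitian_sum g)
  have one: "(\<Sum>\<eta>\<in>S. \<mu> \<eta>) = 1"
    using sum_count_law[OF mk st, of n "\<lambda>_. 1::real"] sum_path_law[OF mk st n]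
    by (simp add: S_def \<mu>_def)
  \<comment> \<open>Centring: every coordinate of the path has law \<pi>, so the empirical mean has
    expectation \<open>mean \<pi> g\<close>.\<close>
  have "(\<Sum>\<eta>\<in>S. \<mu> \<eta> *\<^sub>R G \<eta>) = (\<Sum>u\<in>paths n. path_law p \<pi> n u *\<^sub>R deviation \<pi> g n u)"
    unfolding S_def \<mu>_def by (simp add: sum_count_law[OF mk st] Gdev)
  also have "\<dots> = (1 / real n) *\<^sub>R (\<Sum>i = 1..n. \<Sum>u\<in>paths n. path_law p \<pi> n u *\<^sub>R g (u i)) -
      (\<Sum>u\<in>paths n. path_law p \<pi> n u) *\<^sub>R mean \<pi> g"
    by (subst sum.swap)
      (simp add: deviation_def scaleR_diff_right sum_subtractf scaleR_sum_right scaleR_sum_left mult.commute)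
  also have "\<dots> = (1 / real n) *\<^sub>R (\<Sum>i = 1..n. mean \<pi> g) - mean \<pi> g"
    unfolding sum_path_law[OF mk st n]
    by (simp add: sum_path_law_coordinate[OF mk st])
  also have "\<dots> = 0" using n by (simp only: sum_constant_scaleR) simp
  finally have "mat_op (\<Sum>\<eta>\<in>S. \<mu> \<eta> *\<^sub>R G \<eta>) = 0" by (simp add: linear_0[OF linear_mat_op])
  then have mean: "(\<Sum>\<eta>\<in>S. \<mu> \<eta> *\<^sub>R F \<eta>) = 0"
    by (simp add: F_def linear_sum[OF linear_mat_op] linear_scale[OF linear_mat_op])
  have step: "norm (F \<eta> - F \<xi>) \<le> 2 / real n"
    if S: "\<eta> \<in> S" "\<xi> \<in> S" and ne: "\<mu> \<eta> * K \<eta> \<xi> \<noteq> 0" for \<eta> \<xi>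
  proof -
    from count_step[OF ne[unfolded \<mu>_def K_def] S(1)[unfolded S_def] n, of g]
    obtain y z where yz:
      "(\<Sum>x\<in>UNIV. real (\<eta> x) *\<^sub>R g x) - (\<Sum>x\<in>UNIV. real (\<xi> x) *\<^sub>R g x) = g y - g z" .
    have "G \<eta> - G \<xi> = (1 / real n) *\<^sub>R (g y - g z)"
      unfolding yz[symmetric] G_def by (simp add: scaleR_diff_right)
    then have "F \<eta> - F \<xi> = (1 / real n) *\<^sub>R (mat_op (g y) - mat_op (g z))"
      unfolding F_def
      by (simp add: linear_diff[OF linear_mat_op, symmetric] linear_scale[OF linear_mat_op, symmetric])
    moreover have "norm (mat_op (g y) - mat_op (g z)) \<le> 2"
      using norm_triangle_ineq4[of "mat_op (g y)" "mat_op (g z)"] g(2)[of y] g(2)[of z]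
      by (simp add: norm_mat_op)
    ultimately show ?thesis using n by (simp add: divide_right_mono)
  qed
  \<comment> \<open>With \<open>\<theta> = k / 2\<close> and \<open>r = 2 / n\<close> the product
    \<open>\<theta> * r\<close> is \<open>k / n\<close>, and the condition on
    \<open>\<theta>\<close> becomes the hypothesis on \<open>k\<close>.\<close>
  have "(\<Sum>\<eta>\<in>S. \<mu> \<eta> * ftrace (\<lambda>s. cosh (2 * (k / 2) * s)) (F \<eta>)) \<le> real (3 * DIM(complex ^ 'd))"
  proof (rule expectation_ftrace_cosh_le[where K = K and c = c and r = "2 / real n"])
    show K: "0 \<le> \<mu> \<eta> * K \<eta> \<xi>" if "\<eta> \<in> S" "\<xi> \<in> S" for \<eta> \<xi>
      using that count_flow_nonneg[OF mk st n] by (simp add: S_def \<mu>_def K_def)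
    show "c * variance_on S \<mu> f \<le> dirichlet_form S \<mu> K f" for f
      using c K by (intro spectral_gap_poincare) (auto simp: S_def \<mu>_def K_def count_gap_def)
    show "2 * (k / 2 * (2 / real n))\<^sup>2 \<le> c" using k n by (simp add: power_divide field_simps)
  qed (use mk st n c hG one mean step in \<open>auto simp: S_def \<mu>_def K_def F_def finite_count_supp
      count_law_nonneg count_flow_row count_flow_col intro!: selfadjoint_mat_op\<close>)
  \<comment> \<open>The factor 2 in the real dimension is cancelled by the doubled eigenvalues in
    \<open>two_cosh_op_norm_le\<close>.\<close>
  also have "DIM(complex ^ 'd) = 2 * CARD('d)" by simp
  finally have le: "(\<Sum>\<eta>\<in>S. \<mu> \<eta> * ftrace (\<lambda>s. cosh (k * s)) (F \<eta>)) \<le> 6 * real CARD('d)" by simp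
  have "2 * (\<Sum>u\<in>paths n. path_law p \<pi> n u * cosh (k * op_norm (deviation \<pi> g n u))) =
      (\<Sum>\<eta>\<in>S. \<mu> \<eta> * (2 * cosh (k * op_norm (G \<eta>))))"
    using sum_count_law[OF mk st, of n "\<lambda>\<eta>. 2 * cosh (k * op_norm (G \<eta>))"]
    by (simp add: S_def \<mu>_def Gdev sum_distrib_left mult.left_commute)
  also have "\<dots> \<le> (\<Sum>\<eta>\<in>S. \<mu> \<eta> * ftrace (\<lambda>s. cosh (k * s)) (F \<eta>))"
    unfolding F_def \<mu>_def by (intro sum_mono mult_left_mono two_cosh_op_norm_le hG count_law_nonneg mk st)
  finally show ?thesis using le by simp
qed

lemma op_norm_nonneg: "0 \<le> op_norm A"
  unfolding norm_mat_op[symmetric] by (rule norm_ge_zero)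

section \<open>From exponential moments to mean and tail bounds\<close>

text \<open>Jensen's inequality in tangent form: \<open>1 + y \<le> exp y\<close> at
  \<open>y = k * f u - ln (2 * L)\<close>, a shift which normalises the bound on the exponential
  moment to 1.\<close>

lemma exponential_moment_imp_mean_le:
  fixes L :: real
  assumes w: "\<And>u. u \<in> P \<Longrightarrow> 0 \<le> w u" and one: "(\<Sum>u\<in>P. w u) = 1"
    and L: "0 < L" and le: "(\<Sum>u\<in>P. w u * cosh (k * f u)) \<le> L"
  shows "k * (\<Sum>u\<in>P. w u * f u) \<le> ln (2 * L)"
proof -
  have "1 + k * (\<Sum>u\<in>P. w u * f u) - ln (2 * L) = (\<Sum>u\<in>P. w u * (1 + (k * f u - ln (2 * L))))"
    by (simp add: algebra_simps sum.distrib sum_subtractf one flip: sum_distrib_left sum_distrib_right)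
  also have "\<dots> \<le> (\<Sum>u\<in>P. w u * (cosh (k * f u) / L))"
  proof (intro sum_mono mult_left_mono w)
    fix u
    have "1 + (k * f u - ln (2 * L)) \<le> exp (k * f u - ln (2 * L))" by (rule exp_ge_add_one_self)
    also have "\<dots> = exp (k * f u) / (2 * L)" using L by (simp add: exp_diff)
    also have "\<dots> \<le> cosh (k * f u) / L" using L by (simp add: cosh_field_def field_simps)
    finally show "1 + (k * f u - ln (2 * L)) \<le> cosh (k * f u) / L" .
  qed
  also have "\<dots> \<le> 1"
    using le L by (simp add: flip: sum_divide_distrib)
  finally show ?thesis by simp
qed

text \<open>Markov's inequality for \<open>cosh\<close>; the factor 2 comes from
  \<open>exp x \<le> 2 * cosh x\<close>.\<close>

lemma exponential_moment_imp_tail_le: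
  fixes t :: real
  assumes w: "\<And>u. u \<in> P \<Longrightarrow> 0 \<le> w u" and le: "(\<Sum>u\<in>P. w u * cosh (k * f u)) \<le> L"
    and k: "0 \<le> k" and t: "0 \<le> t"
  shows "(\<Sum>u\<in>P. w u * (if t \<le> f u then 1 else 0)) \<le> 2 * L * exp (- (k * t))"
proof -
  have "exp (k * t) / 2 * (\<Sum>u\<in>P. w u * (if t \<le> f u then 1 else 0)) \<le> (\<Sum>u\<in>P. w u * cosh (k * f u))"
    unfolding sum_distrib_left
  proof (rule sum_mono)
    fix u assume u: "u \<in> P"
    have "exp (k * t) / 2 \<le> cosh (k * f u)" if "t \<le> f u"
    proof -
      have "exp (k * t) / 2 \<le> cosh (k * t)" by (simp add: cosh_field_def)
      also have "\<dots> \<le> cosh (k * f u)"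
        using that k t by (subst cosh_real_nonneg_le_iff) (auto intro: mult_left_mono)
      finally show ?thesis .
    qed
    then show "exp (k * t) / 2 * (w u * (if t \<le> f u then 1 else 0)) \<le> w u * cosh (k * f u)"
      using w[OF u] mult_left_mono[of "exp (k * t) / 2" "cosh (k * f u)" "w u"] by (auto simp: mult.commute)
  qed
  also note le
  finally show ?thesis by (simp add: exp_minus field_simps)
qed

lemma distributed_path_law_expectation:
  fixes \<phi> :: "(nat \<Rightarrow> 'a::finite) \<Rightarrow> real"
  assumes mk: "markov_kernel p" and st: "stationary p \<pi>"
    and dist: "distributed M (count_space (paths n)) U (\<lambda>u. ennreal (path_law p \<pi> n u))"
  shows "(\<integral>\<omega>. \<phi> (U \<omega>) \<partial>M) = (\<Sum>u\<in>paths n. path_law p \<pi> n u * \<phi> u)"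
proof -
  have "(\<integral>\<omega>. \<phi> (U \<omega>) \<partial>M) = (\<integral>u. path_law p \<pi> n u * \<phi> u \<partial>count_space (paths n))"
    by (rule distributed_integral[OF dist, symmetric]) (auto intro: path_law_nonneg[OF mk st])
  then show ?thesis by (simp add: lebesgue_integral_count_space_finite finite_paths)
qed

theorem theorem8p1:
  fixes p :: "'a::finite \<Rightarrow> 'a \<Rightarrow> real"
    and \<pi> :: "'a \<Rightarrow> real"
    and n :: nat
    and M :: "'w measure"
    and U :: "'w \<Rightarrow> nat \<Rightarrow> 'a"
    and g :: "'a \<Rightarrow> complex ^ 'd ^ 'd"
  assumes "CARD('a) \<ge> 2"
    and "markov_kernel p"
    and "irreducible_kernel p"
    and "stationary p \<pi>"
    and "reversible p \<pi>"
    and "n \<ge> 2"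
    and "prob_space M"
    and "distributed M (count_space (paths n)) U (\<lambda>u. ennreal (path_law p \<pi> n u))"
    and "\<And>x. hermitian (g x)"
    and "(MAX x. op_norm (g x)) \<le> 1"
  shows "(\<forall>t>0.
      ereal (measure M {\<omega> \<in> space M.
        op_norm ((1 / real n) *\<^sub>R (\<Sum>i = 1..n. g (U \<omega> i)) - mean \<pi> g) \<ge> t})
      \<le> ereal (6 * real CARD('d)) *
        ereal_exp (- (ereal (real n) * ereal_sqrt (count_gap p \<pi> n / 2) * ereal t)))
    \<and> ereal (\<integral>\<omega>. op_norm ((1 / real n) *\<^sub>R (\<Sum>i = 1..n. g (U \<omega> i)) - mean \<pi> g) \<partial>M)
      \<le> ereal (sqrt 2 * ln (6 * exp 1 * real CARD('d))) /
        (ereal (real n) * ereal_sqrt (count_gap p \<pi> n))"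
proof -
  note mk = assms(2) and st = assms(4) and dist = assms(8)
  have n: "1 \<le> n" using assms(6) by simp
  have g1: "op_norm (g x) \<le> 1" for x
    using assms(10) Max_ge[of "range (\<lambda>x. op_norm (g x))" "op_norm (g x)"] by simp
  define d where "d = real CARD('d)"
  have d: "1 \<le> d" by (simp add: d_def Suc_leI)
  define N where "N u = op_norm (deviation \<pi> g n u)" for u
  define w where "w = path_law p \<pi> n"
  define m where "m = (\<Sum>u\<in>paths n. w u * N u)"
  define tail where "tail t = (\<Sum>u\<in>paths n. w u * (if t \<le> N u then 1 else 0))" for t
  have w: "0 \<le> w u" for u unfolding w_def by (rule path_law_nonneg[OF mk st])
  have one: "(\<Sum>u\<in>paths n. w u) = 1" unfolding w_def by (rule sum_path_law[OF mk st n])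
  have N0: "0 \<le> N u" for u unfolding N_def by (rule op_norm_nonneg)
  have gap0: "0 \<le> count_gap p \<pi> n"
    unfolding count_gap_def using count_flow_nonneg[OF mk st n] by (intro spectral_gap_nonneg)
  have moment: "(\<Sum>u\<in>paths n. w u * cosh (k * N u)) \<le> 3 * d"
    if "0 < c" "ereal c \<le> count_gap p \<pi> n" "2 * k\<^sup>2 \<le> (real n)\<^sup>2 * c" for c k
    using sum_path_law_cosh_deviation_le[OF mk st n assms(9) g1 that] by (simp add: w_def N_def d_def)
  have expectation: "(\<integral>\<omega>. op_norm ((1 / real n) *\<^sub>R (\<Sum>i = 1..n. g (U \<omega> i)) - mean \<pi> g) \<partial>M) = m"
    using distributed_path_law_expectation[OF mk st dist, of N]
    by (simp add: N_def deviation_def m_def w_def)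
  have prob: "measure M {\<omega> \<in> space M.
        op_norm ((1 / real n) *\<^sub>R (\<Sum>i = 1..n. g (U \<omega> i)) - mean \<pi> g) \<ge> t} = tail t" for t
  proof -
    have "measure M {\<omega> \<in> space M. t \<le> N (U \<omega>)} =
        (\<integral>\<omega>. indicator {\<omega> \<in> space M. t \<le> N (U \<omega>)} \<omega> \<partial>M)"
      by (simp add: Int_def conj_commute)
    also have "\<dots> = (\<integral>\<omega>. (if t \<le> N (U \<omega>) then 1 else 0) \<partial>M)"
      by (intro Bochner_Integration.integral_cong) (auto simp: indicator_def)
    also have "\<dots> = tail t"
      unfolding tail_def w_def by (rule distributed_path_law_expectation[OF mk st dist])
    finally show ?thesis by (simp add: N_def deviation_def)
  qed
  have tail1: "tail t \<le> 1" for t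
  proof -
    have "tail t \<le> (\<Sum>u\<in>paths n. w u)" unfolding tail_def by (intro sum_mono) (auto simp: w)
    then show ?thesis by (simp add: one)
  qed
  \<comment> \<open>The moment bound gives the constant \<open>ln (6 * d)\<close>, which is relaxed
    to the stated one.\<close>
  have ln_le: "ln (6 * d) \<le> ln (6 * exp 1 * d)"
    using d by (simp add: ln_mult)
  have ln_pos: "0 < ln (6 * d)" using d by simp
  consider "count_gap p \<pi> n = 0" | c where "count_gap p \<pi> n = ereal c" "0 < c" | "count_gap p \<pi> n = \<infinity>"
    using gap0 by (cases "count_gap p \<pi> n") (auto simp: zero_ereal_def order.order_iff_strict)
  then have "(\<forall>t>0. ereal (tail t) \<le> ereal (6 * d) *
      ereal_exp (- (ereal (real n) * ereal_sqrt (count_gap p \<pi> n / 2) * ereal t)))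
    \<and> ereal m \<le> ereal (sqrt 2 * ln (6 * exp 1 * d)) / (ereal (real n) * ereal_sqrt (count_gap p \<pi> n))"
  proof cases
    case 1
    \<comment> \<open>At gap zero the exponential is 1 and \<open>6 * d\<close> exceeds every
      probability; the bound on the mean is a positive number divided by zero, which is infinite in
      \<open>ereal\<close>.\<close>
    have "tail t \<le> 6 * d" for t using tail1[of t] d by linarith
    moreover have "ereal (sqrt 2 * ln (6 * exp 1 * d)) / 0 = \<infinity>"
      using ln_pos ln_le by (simp add: divide_ereal_def)
    ultimately show ?thesis
      by (simp add: 1 ereal_sqrt_def ereal_exp_def flip: zero_ereal_def)
  next
    case (2 c)
    \<comment> \<open>The largest admissible exponent, with equality in
      \<open>2 * k\<^sup>2 \<le> (real n)\<^sup>2 * c\<close>.\<close>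
    define k where "k = real n * sqrt (c / 2)"
    have k: "0 < k" using n 2 by (simp add: k_def)
    have mom: "(\<Sum>u\<in>paths n. w u * cosh (k * N u)) \<le> 3 * d"
      using 2 by (intro moment[of c]) (auto simp: k_def power_mult_distrib)
    have "tail t \<le> 6 * d * exp (- (k * t))" if "0 < t" for t
      using exponential_moment_imp_tail_le[OF w mom, of t] k that by (simp add: tail_def)
    moreover have "m \<le> sqrt 2 * ln (6 * exp 1 * d) / (real n * sqrt c)"
    proof -
      have "k * m \<le> ln (6 * d)"
        using exponential_moment_imp_mean_le[OF w one _ mom] d by (simp add: m_def)
      also note ln_le
      finally have "m \<le> ln (6 * exp 1 * d) / k" using k by (simp add: field_simps)
      also have "\<dots> = sqrt 2 * ln (6 * exp 1 * d) / (real n * sqrt c)"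
        by (simp add: k_def real_sqrt_divide)
      finally show ?thesis .
    qed
    ultimately show ?thesis
      using 2 n by (simp add: ereal_sqrt_def ereal_exp_def k_def)
  next
    case 3
    \<comment> \<open>At infinite gap every \<open>k\<close> is admissible: \<open>c\<close> is
      chosen so that the condition on \<open>k\<close> holds with equality.\<close>
    have "k * m \<le> ln (6 * d)" if k: "0 < k" for k
    proof -
      have "(\<Sum>u\<in>paths n. w u * cosh (k * N u)) \<le> 3 * d"
        using k n by (intro moment[of "2 * k\<^sup>2 / (real n)\<^sup>2"]) (auto simp: 3)
      from exponential_moment_imp_mean_le[OF w one _ this] show ?thesis
        using d by (simp add: m_def)
    qed
    \<comment> \<open>For positive \<open>m\<close> this \<open>k\<close> would give
      \<open>ln (6 * d) + 1 \<le> ln (6 * d)\<close>.\<close>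
    from this[of "(ln (6 * d) + 1) / m"] have m: "m \<le> 0"
      using ln_pos by (cases "0 < m") (auto simp: field_simps)
    have "tail t \<le> 0" if "0 < t" for t
    proof -
      \<comment> \<open>Markov's inequality: a vanishing mean forces vanishing tails.\<close>
      have "t * tail t \<le> m"
        unfolding tail_def m_def sum_distrib_left
        by (intro sum_mono) (auto simp: w N0 mult.commute intro: mult_right_mono)
      then show ?thesis using m that by (meson mult_pos_pos not_le order_trans)
    qed
    then show ?thesis
      using 3 n m by (simp add: ereal_sqrt_def ereal_exp_def)
  qed
  then show ?thesis unfolding prob expectation d_def .
qed

end
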